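(* Let $n\ge 2$. For every integer $t$, the number $G_{n,t}^{(n-1)}$ of fixed polycubes of size $n$ that are proper in dimension $n-1$ and have perimeter $t$ in $\mathbb{Z}^{n-1}$ is $$G_{n,t}^{(n-1)}=\sum_{\delta\,:\;t_1(\delta)=t} 2^{n-1}\,\frac1n\,\frac{\big(\alpha_1(\delta)+\cdots+\alpha_{n-1}(\delta)\big)!}{\alpha_1(\delta)!\cdots\alpha_{n-1}(\delta)!}\cdot\frac{\big((\delta_1-1)+\cdots+(\delta_n-1)\big)!}{(\delta_1-1)!\cdots(\delta_n-1)!},$$ where the sum runs over all sorted degree sequences $\delta=(\delta_1\le\cdots\le\delta_n)$ of trees with $n$ vertices (i.e. sorted sequences of positive integers with $\sum_i\delta_i=2(n-1)$) that satisfy $t_1(\delta)=t$, with $$t_1(\delta)=(2n-1)(n-1)-\frac12\sum_{i=1}^n\delta_i^2 ,$$ and $\alpha_k(\delta)$ is the number of indices $i$ with $\delta_i=k$.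
   Context: A $d$-dimensional polycube of size $n$ is a face-connected set of $n$ cells of the lattice $\mathbb{Z}^d$ (two cells are face-connected neighbours if they differ by $\pm e_i$ for some standard basis vector $e_i$). Fixed polycubes are counted up to translation only: they are distinct if they have different shapes or orientations. The perimeter of a polycube in $\mathbb{Z}^d$ is the number of cells of $\mathbb{Z}^d$ not in the polycube that are adjacent to at least one cell of the polycube. A polycube is proper in $i$ dimensions if it spans exactly $i$ dimensions. $G_{n,t}^{(i)}$ denotes the number of fixed polycubes in $\mathbb{Z}^i$ of size $n$ that are proper in dimension $i$ and have perimeter $t$ in $\mathbb{Z}^i$. *)

theory Defs
  imports "HOL-Analysis.Analysis"
begin

(* Z^d is the type int ^ 'd with d = CARD('d). A cell is represented by its lattice point. *)

definition cell_adjacent :: "int ^ 'd \<Rightarrow> int ^ 'd \<Rightarrow> bool" where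
  "cell_adjacent x y \<longleftrightarrow> (\<exists>i. y = x + axis i 1 \<or> y = x - axis i 1)"

definition face_connected :: "(int ^ 'd) set \<Rightarrow> bool" where
  "face_connected P \<longleftrightarrow>
     (\<forall>x\<in>P. \<forall>y\<in>P. (x, y) \<in> {(u, v). u \<in> P \<and> v \<in> P \<and> cell_adjacent u v}\<^sup>*)"

definition polycube :: "nat \<Rightarrow> (int ^ 'd) set \<Rightarrow> bool" where
  "polycube n P \<longleftrightarrow> finite P \<and> card P = n \<and> face_connected P"

definition perimeter :: "(int ^ 'd) set \<Rightarrow> nat" where
  "perimeter P = card {c. c \<notin> P \<and> (\<exists>p\<in>P. cell_adjacent p c)}"

(* The dimension spanned by a polycube is that of the affine (equivalently, convex) hull of the
   centres of its cells, not of the union of the cells as solid cubes, which always has full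
   dimension. *)
definition proper_in :: "nat \<Rightarrow> (int ^ 'd) set \<Rightarrow> bool" where
  "proper_in k P \<longleftrightarrow> aff_dim ((\<lambda>x. (\<chi> i. real_of_int (x $ i)) :: real ^ 'd) ` P) = int k"

definition translation_rel :: "((int ^ 'd) set \<times> (int ^ 'd) set) set" where
  "translation_rel = {(P, Q). \<exists>v. Q = (\<lambda>x. x + v) ` P}"

(* G_{n,t}^{(d)} with d = CARD('d): fixed polycubes are translation classes. *)
definition num_proper_polycubes :: "'d::finite itself \<Rightarrow> nat \<Rightarrow> int \<Rightarrow> nat" where
  "num_proper_polycubes _ n t =
     card ({P :: (int ^ 'd) set. polycube n P \<and> proper_in CARD('d) P \<and> int (perimeter P) = t}
           // translation_rel)"

(* For n >= 2 these are exactly the sorted degree sequences of trees with n vertices. *)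
definition tree_degree_seqs :: "nat \<Rightarrow> nat list set" where
  "tree_degree_seqs n =
     {\<delta>. length \<delta> = n \<and> sorted \<delta> \<and> (\<forall>d\<in>set \<delta>. d > 0) \<and> sum_list \<delta> = 2 * (n - 1)}"

definition t1 :: "nat \<Rightarrow> nat list \<Rightarrow> real" where
  "t1 n \<delta> = (2 * real n - 1) * (real n - 1) - 1 / 2 * (\<Sum>i<n. real (\<delta> ! i) ^ 2)"

definition alpha :: "nat \<Rightarrow> nat list \<Rightarrow> nat" where
  "alpha k \<delta> = card {i. i < length \<delta> \<and> \<delta> ! i = k}"

end

theory Submission
  imports Defs "HOL-Combinatorics.Multiset_Permutations"
begin

text \<open>
  A proper polycube of size \<open>n\<close> in dimension \<open>n - 1\<close> contains, for every direction \<open>i\<close>, two cells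
  that differ by the unit vector of \<open>i\<close>; otherwise all cells would lie in a hyperplane. Choosing
  one such pair per direction gives \<open>n - 1\<close> edges on \<open>n\<close> cells. These edges form a tree, because the
  unit vectors could not be spanned by the differences inside two separate parts of the cells
  (\<open>drawing_tree\<close>). Conversely every tree whose edges are directed and labelled
  bijectively by the directions can be drawn in the lattice, uniquely up to translation
  (\<open>tree_potential\<close>, \<open>tree_potential_unique\<close>), and its cells form a
  proper polycube. The cells of a drawn tree are affinely independent
  (\<open>drawing_affine_independent\<close>). Hence the drawing is injective and determines its tree
  (\<open>drawing_unique_edges\<close>), and each translation class of proper polycubes arises from
  exactly \<open>n!\<close> trees on the vertices \<open>0, \<dots>, n - 1\<close>, one for each numbering of its cells
  (\<open>card_tree_shape_fibre\<close>).

  Affine independence also yields the perimeter. A cell adjacent to a cell \<open>p\<close> has the form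
  \<open>p + b - a\<close> with \<open>a\<close> and \<open>b\<close> neighbours in the tree. It is outside the polycube exactly if
  \<open>a \<noteq> p\<close>, and it then determines \<open>a\<close> and the unordered pair of \<open>p\<close> and \<open>b\<close>. So a vertex
  \<open>a\<close> of degree \<open>\<delta>\<close> accounts for \<open>\<delta> (n - 1) - \<delta> (\<delta> - 1) / 2\<close> outer cells
  (\<open>drawing_perimeter\<close>), and these numbers add up to \<open>t\<^sub>1\<close>.

  What remains is to count labelled directed trees by their degrees. Removing a leaf gives a
  recursion that is solved by
  \<open>2 ^ (n - 1) * (n - 1)! * (n - 2)! / \<Prod> (\<delta>\<^sub>v - 1)!\<close> for prescribed degrees \<open>\<delta>\<^sub>v\<close>
  (\<open>card_degree_trees\<close>). Multiplying by the number of rearrangements of the sorted degree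
  sequence and dividing by \<open>n!\<close> gives the stated formula.
\<close>

section \<open>Trees with labelled directed edges\<close>

text \<open>The indices in \<open>I\<close> are the edges and \<open>E\<close> gives their tail and head. Connectedness is stated as:
  every proper nonempty set of vertices is left by some edge. In this form it passes to a tree
  with a leaf removed or added without any reasoning about paths. Together with the number of edges
  it characterises trees.\<close>

definition tree :: "'v set \<Rightarrow> 'e set \<Rightarrow> ('e \<Rightarrow> 'v \<times> 'v) \<Rightarrow> bool" where
  "tree V I E \<longleftrightarrow> finite V \<and> finite I \<and> card V = Suc (card I) \<and> (\<forall>i\<in>I. E i \<in> V \<times> V) \<and>
     (\<forall>S. S \<noteq> {} \<longrightarrow> S \<subset> V \<longrightarrow> (\<exists>i\<in>I. fst (E i) \<in> S \<longleftrightarrow> snd (E i) \<notin> S))"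

text \<open>A loop would count twice, so that the degrees always add up to twice the number of edges.\<close>

definition vertex_degree :: "'e set \<Rightarrow> ('e \<Rightarrow> 'v \<times> 'v) \<Rightarrow> 'v \<Rightarrow> nat" where
  "vertex_degree I E v = (\<Sum>i\<in>I. of_bool (fst (E i) = v) + of_bool (snd (E i) = v))"

lemma tree_cong:
  assumes "\<And>i. i \<in> I \<Longrightarrow> E i = E' i"
  shows "tree V I E \<longleftrightarrow> tree V I E'"
  using assms unfolding tree_def by (auto cong: ball_cong bex_cong)

lemma degree_cong:
  assumes "\<And>i. i \<in> I \<Longrightarrow> E i = E' i"
  shows "vertex_degree I E v = vertex_degree I E' v"
  using assms unfolding vertex_degree_def by (auto intro!: sum.cong)

lemma sum_degree:
  assumes "finite V" "finite I" "\<And>i. i \<in> I \<Longrightarrow> E i \<in> V \<times> V"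
  shows "(\<Sum>v\<in>V. vertex_degree I E v) = 2 * card I"
proof -
  have "(\<Sum>v\<in>V. vertex_degree I E v)
      = (\<Sum>i\<in>I. \<Sum>v\<in>V. of_bool (fst (E i) = v) + of_bool (snd (E i) = v))"
    unfolding vertex_degree_def by (rule sum.swap)
  also have "\<dots> = (\<Sum>i\<in>I. 2)"
  proof (rule sum.cong[OF refl])
    fix i assume "i \<in> I"
    then have "fst (E i) \<in> V" "snd (E i) \<in> V"
      using assms(3) by (auto simp: mem_Times_iff)
    then show "(\<Sum>v\<in>V. of_bool (fst (E i) = v) + of_bool (snd (E i) = v)) = (2::nat)"
      using assms(1) by (simp add: sum.distrib of_bool_def)
  qed
  finally show ?thesis by simp
qed

lemma degree_pos:
  assumes "tree V I E" "v \<in> V" "card V \<ge> 2"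
  shows "vertex_degree I E v > 0"
proof -
  have "V \<noteq> {v}" using assms(3) by auto
  then have "{v} \<subset> V" using assms(2) by blast
  then obtain i where i: "i \<in> I" "fst (E i) \<in> {v} \<longleftrightarrow> snd (E i) \<notin> {v}"
    using assms(1) unfolding tree_def by blast
  have "finite I" using assms(1) by (simp add: tree_def)
  have "0 < (of_bool (fst (E i) = v) + of_bool (snd (E i) = v) :: nat)" using i by auto
  also have "\<dots> \<le> vertex_degree I E v"
    unfolding vertex_degree_def by (rule member_le_sum) (use i \<open>finite I\<close> in auto)
  finally show ?thesis .
qed

lemma degree_one_edge:
  assumes "vertex_degree I E v = 1" "finite I"
  obtains i w where "i \<in> I" "w \<noteq> v" "E i = (v, w) \<or> E i = (w, v)"
    "\<And>j. j \<in> I - {i} \<Longrightarrow> fst (E j) \<noteq> v \<and> snd (E j) \<noteq> v"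
proof -
  let ?f = "\<lambda>i. of_bool (fst (E i) = v) + of_bool (snd (E i) = v) :: nat"
  obtain i where i: "i \<in> I" "?f i = 1" "\<forall>j\<in>I. j \<noteq> i \<longrightarrow> ?f j = 0"
    using assms sum_eq_1_iff[OF assms(2), of ?f] unfolding vertex_degree_def by auto
  obtain a b where ab: "E i = (a, b)" by fastforce
  define w where "w = (if a = v then b else a)"
  show thesis
  proof (rule that[of i w])
    show "w \<noteq> v" "E i = (v, w) \<or> E i = (w, v)"
      using i(2) ab by (auto simp: w_def of_bool_def split: if_splits)
    show "fst (E j) \<noteq> v \<and> snd (E j) \<noteq> v" if "j \<in> I - {i}" for j
      using i(3) that by (auto split: if_splits)
  qed (use i in auto)
qed

text \<open>The average degree is less than two, so a positive degree sequence contains a one.\<close>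

lemma leaf_exists:
  assumes "finite V" "\<And>v. v \<in> V \<Longrightarrow> d v > 0" "(\<Sum>v\<in>V. d v) = 2 * (card V - 1)" "V \<noteq> {}"
  obtains v where "v \<in> V" "d v = (1::nat)"
proof -
  have "\<exists>v\<in>V. d v = 1"
  proof (rule ccontr)
    assume "\<not> ?thesis"
    then have "d v \<ge> 2" if "v \<in> V" for v using assms(2)[OF that] that by force
    then have "(\<Sum>v\<in>V. 2) \<le> (\<Sum>v\<in>V. d v)" by (intro sum_mono) auto
    moreover have "card V > 0" using assms by (simp add: card_gt_0_iff)
    ultimately show False using assms(3) by simp
  qed
  then show thesis using that by blast
qed

lemma tree_remove_leaf:
  assumes "tree V I E" "i \<in> I" "v \<in> V" "w \<in> V - {v}" "E i = (v, w) \<or> E i = (w, v)"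
    and "\<And>j. j \<in> I - {i} \<Longrightarrow> fst (E j) \<noteq> v \<and> snd (E j) \<noteq> v"
  shows "tree (V - {v}) (I - {i}) E"
proof -
  have cut: "\<exists>j\<in>I - {i}. fst (E j) \<in> S \<longleftrightarrow> snd (E j) \<notin> S"
    if S: "S \<noteq> {}" "S \<subset> V - {v}" for S
  proof -
    (* Put v on the same side of the cut as w, so that the edge between them does not cross. *)
    define S' where "S' = (if w \<in> S then insert v S else S)"
    have "S' \<noteq> {}" "S' \<subset> V" using S assms(3,4) by (auto simp: S'_def)
    then obtain j where j: "j \<in> I" "fst (E j) \<in> S' \<longleftrightarrow> snd (E j) \<notin> S'"
      using assms(1) unfolding tree_def by blast
    have "v \<notin> S" using S by auto
    moreover have "(fst (E i) = v \<and> snd (E i) = w) \<or> (fst (E i) = w \<and> snd (E i) = v)"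
      using assms(5) by (elim disjE) simp_all
    ultimately have "j \<noteq> i" using j(2) by (metis S'_def insertE insertI1 insertI2)
    then show ?thesis using j assms(6)[of j] by (auto simp: S'_def split: if_splits)
  qed
  have ends: "E j \<in> (V - {v}) \<times> (V - {v})" if "j \<in> I - {i}" for j
    using assms(1) assms(6)[OF that] that unfolding tree_def mem_Times_iff by blast
  have "card I > 0" using assms(1,2) by (auto simp: tree_def card_gt_0_iff)
  then have "card (V - {v}) = Suc (card (I - {i}))"
    using assms(1-3) by (simp add: tree_def)
  then show ?thesis using assms(1) cut ends unfolding tree_def by simp
qed

lemma tree_add_leaf:
  assumes "tree V I E" "i \<notin> I" "v \<notin> V" "w \<in> V" "E i = (v, w) \<or> E i = (w, v)"
  shows "tree (insert v V) (insert i I) E"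
proof -
  have "\<exists>j\<in>insert i I. fst (E j) \<in> S \<longleftrightarrow> snd (E j) \<notin> S"
    if S: "S \<noteq> {}" "S \<subset> insert v V" for S
  proof (cases "S \<inter> V \<noteq> {} \<and> S \<inter> V \<subset> V")
    case True
    then obtain j where j: "j \<in> I" "fst (E j) \<in> S \<inter> V \<longleftrightarrow> snd (E j) \<notin> S \<inter> V"
      using assms(1) unfolding tree_def by meson
    moreover have "E j \<in> V \<times> V" using j(1) assms(1) by (simp add: tree_def)
    ultimately show ?thesis by (auto simp: mem_Times_iff)
  next
    case False
    then have "S = {v} \<or> S = V" using S assms(3) by blast
    moreover have "(fst (E i) = v \<and> snd (E i) = w) \<or> (fst (E i) = w \<and> snd (E i) = v)"
      using assms(5) by (elim disjE) simp_all
    ultimately have "fst (E i) \<in> S \<longleftrightarrow> snd (E i) \<notin> S" using assms(3,4) by auto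
    then show ?thesis by blast
  qed
  moreover have "\<forall>j\<in>insert i I. E j \<in> insert v V \<times> insert v V"
    using assms unfolding tree_def by (auto simp: mem_Times_iff)
  ultimately show ?thesis using assms unfolding tree_def by simp
qed

text \<open>Every tree grows from a single vertex by attaching leaves: the degrees of a tree with at
  least one edge force a leaf, and removing it leaves a tree.\<close>

lemma tree_induct [consumes 1, case_names single leaf]:
  assumes "tree V I E"
    and "\<And>v. P {v} {}"
    and "\<And>V I v w i. tree V I E \<Longrightarrow> v \<notin> V \<Longrightarrow> w \<in> V \<Longrightarrow> i \<notin> I \<Longrightarrow>
           E i = (v, w) \<or> E i = (w, v) \<Longrightarrow> P V I \<Longrightarrow> P (insert v V) (insert i I)"
  shows "P V I"
  using assms(1)
proof (induction "card I" arbitrary: V I)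
  case 0
  then have "card V = 1" "I = {}" by (auto simp: tree_def)
  then show ?case using assms(2) by (auto simp: card_1_singleton_iff)
next
  case (Suc k)
  note tree = Suc.prems
  then have fin: "finite V" "finite I" and c: "card V = Suc (card I)" by (auto simp: tree_def)
  have ends: "E i \<in> V \<times> V" if "i \<in> I" for i using tree that by (auto simp: tree_def)
  obtain v where v: "v \<in> V" "vertex_degree I E v = 1"
    using leaf_exists[OF fin(1), of "vertex_degree I E"] degree_pos[OF tree] sum_degree[OF fin ends]
      c Suc.hyps(2) by force
  obtain i w where e: "i \<in> I" "w \<noteq> v" "E i = (v, w) \<or> E i = (w, v)"
    "\<And>j. j \<in> I - {i} \<Longrightarrow> fst (E j) \<noteq> v \<and> snd (E j) \<noteq> v"
    using degree_one_edge[OF v(2) fin(2)] by metis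
  have w: "w \<in> V - {v}" using e ends[OF e(1)] by auto
  have t: "tree (V - {v}) (I - {i}) E"
    using tree_remove_leaf[OF tree e(1) v(1) w e(3,4)] .
  have "P (V - {v}) (I - {i})"
    by (rule Suc.hyps(1)) (use t Suc.hyps(2) e(1) in auto)
  then have "P (insert v (V - {v})) (insert i (I - {i}))"
    by (intro assms(3)[OF t _ w _ e(3)]) auto
  then show ?case using v e by (simp add: insert_absorb)
qed

text \<open>The level set of one value would otherwise be a cut that no edge crosses.\<close>

lemma tree_const:
  assumes "tree V I E" "\<And>i. i \<in> I \<Longrightarrow> f (fst (E i)) = f (snd (E i))" "v \<in> V" "w \<in> V"
  shows "f v = f w"
proof (rule ccontr)
  assume ne: "f v \<noteq> f w"
  let ?S = "{x \<in> V. f x = f v}"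
  have "v \<in> ?S" "w \<notin> ?S" using assms(3) ne by auto
  then have "?S \<noteq> {}" "?S \<subset> V" using assms(4) by blast+
  then obtain i where i: "i \<in> I" "fst (E i) \<in> ?S \<longleftrightarrow> snd (E i) \<notin> ?S"
    using assms(1) unfolding tree_def by meson
  moreover have "E i \<in> V \<times> V" using i assms(1) by (simp add: tree_def)
  ultimately show False using assms(2)[OF i(1)] by (auto simp: mem_Times_iff)
qed

text \<open>A tree has no cycles, so differences along the edges can be prescribed freely. This is what
  allows each labelled tree to be drawn in the lattice.\<close>

lemma tree_potential:
  fixes s :: "'e \<Rightarrow> 'a::ab_group_add"
  assumes "tree V I E"
  shows "\<exists>g. \<forall>i\<in>I. g (snd (E i)) = g (fst (E i)) + s i"
  using assms
proof (induction rule: tree_induct)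
  case (single v)
  then show ?case by simp
next
  case (leaf V I v w i)
  then obtain g where g: "\<forall>i\<in>I. g (snd (E i)) = g (fst (E i)) + s i" by blast
  define g' where "g' = g(v := (if E i = (w, v) then g w + s i else g w - s i))"
  have "g' (snd (E j)) = g' (fst (E j)) + s j" if "j \<in> I" for j
  proof -
    have "E j \<in> V \<times> V" using that leaf(1) by (simp add: tree_def)
    then have "fst (E j) \<noteq> v" "snd (E j) \<noteq> v" using leaf(2) by auto
    then show ?thesis using g that by (simp add: g'_def)
  qed
  moreover have "g' (snd (E i)) = g' (fst (E i)) + s i"
  proof (cases "E i = (w, v)")
    case True
    then show ?thesis using leaf(2,3) by (auto simp: g'_def)
  next
    case False
    then have "E i = (v, w)" using leaf(5) by blast
    then show ?thesis using leaf(2,3) by (auto simp: g'_def)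
  qed
  ultimately show ?case by blast
qed

lemma tree_potential_unique:
  fixes s :: "'e \<Rightarrow> 'a::ab_group_add"
  assumes "tree V I E"
    and "\<And>i. i \<in> I \<Longrightarrow> g (snd (E i)) = g (fst (E i)) + s i"
    and "\<And>i. i \<in> I \<Longrightarrow> g' (snd (E i)) = g' (fst (E i)) + s i"
  obtains c where "\<And>v. v \<in> V \<Longrightarrow> g' v = g v + c"
proof -
  have "V \<noteq> {}" using assms(1) by (auto simp: tree_def)
  then obtain w where w: "w \<in> V" by blast
  have "g' v - g v = g' w - g w" if "v \<in> V" for v
    by (rule tree_const[OF assms(1) _ that w]) (simp add: assms(2,3))
  then have "g' v = g v + (g' w - g w)" if "v \<in> V" for v
    using that by (metis add.commute diff_add_cancel)
  then show thesis using that by blast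
qed

section \<open>Counting trees with given degrees\<close>

definition degree_trees :: "'v set \<Rightarrow> 'e set \<Rightarrow> ('v \<Rightarrow> nat) \<Rightarrow> ('e \<Rightarrow> 'v \<times> 'v) set" where
  "degree_trees V I d = {E \<in> I \<rightarrow>\<^sub>E V \<times> V. tree V I E \<and> (\<forall>v\<in>V. vertex_degree I E v = d v)}"

lemma degree_remove:
  assumes "finite I" "i \<in> I" "E i = (v, w) \<or> E i = (w, v)"
  shows "vertex_degree I E u = vertex_degree (I - {i}) E u + of_bool (u = v) + of_bool (u = w)"
proof -
  have "of_bool (fst (E i) = u) + of_bool (snd (E i) = u) = (of_bool (u = v) + of_bool (u = w) :: nat)"
    using assms(3) by (elim disjE) (simp_all add: eq_commute)
  then show ?thesis unfolding vertex_degree_def using assms(1,2) by (subst sum.remove[of _ i]) auto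
qed

lemma degree_outside:
  assumes "E \<in> I \<rightarrow>\<^sub>E V \<times> V" "v \<notin> V"
  shows "vertex_degree I E v = 0"
proof -
  have "fst (E i) \<noteq> v" "snd (E i) \<noteq> v" if "i \<in> I" for i
    using PiE_mem[OF assms(1) that] assms(2) by (auto simp: mem_Times_iff)
  then show ?thesis by (simp add: vertex_degree_def)
qed

lemma tree_single: "tree {v} {} E"
proof -
  have "\<forall>S. S \<noteq> {} \<longrightarrow> \<not> S \<subset> {v}" by blast
  then show ?thesis unfolding tree_def by simp
qed

lemma finite_degree_trees:
  assumes "finite V" "finite I"
  shows "finite (degree_trees V I d)"
  by (rule finite_subset[of _ "I \<rightarrow>\<^sub>E V \<times> V"])
    (use assms in \<open>auto simp: degree_trees_def intro: finite_PiE\<close>)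

text \<open>Given that \<open>v\<close> has degree one, a tree is determined by the label \<open>i\<close> of the edge at \<open>v\<close>, its
  other end \<open>w\<close>, its direction (the factor 2) and the tree that remains without \<open>v\<close>, in which the
  degree of \<open>w\<close> has dropped by one.\<close>

lemma card_degree_trees_leaf:
  assumes fin: "finite V" "finite I" and c: "card V = Suc (card I)"
    and pos: "\<And>v. v \<in> V \<Longrightarrow> d v > 0" and v: "v \<in> V" "d v = 1"
  shows "card (degree_trees V I d) = (\<Sum>i\<in>I. \<Sum>w\<in>V - {v}.
           2 * card (degree_trees (V - {v}) (I - {i}) (d(w := d w - 1))))"
proof -
  define T where "T i w = degree_trees (V - {v}) (I - {i}) (d(w := d w - 1))" for i w
  define D where "D = (SIGMA i : I. SIGMA w : V - {v}. (UNIV :: bool set) \<times> T i w)"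
  define \<Phi> where "\<Phi> = (\<lambda>(i, w, out, E :: 'b \<Rightarrow> 'a \<times> 'a). E(i := if out then (v, w) else (w, v)))"
  have T_PiE: "E \<in> (I - {i}) \<rightarrow>\<^sub>E (V - {v}) \<times> (V - {v})" if "E \<in> T i w" for E i w
    using that by (simp add: T_def degree_trees_def)
  have avoid: "fst (E j) \<noteq> v" "snd (E j) \<noteq> v" if "E \<in> T i w" "j \<in> I" "j \<noteq> i" for E i w j
    using PiE_mem[OF T_PiE[OF that(1)], of j] that(2,3) by (auto simp: mem_Times_iff)
  have inj: "inj_on \<Phi> D"
  proof (rule inj_onI)
    fix y y' assume D: "y \<in> D" "y' \<in> D" and \<Phi>_eq: "\<Phi> y = \<Phi> y'"
    obtain i w out E where y: "y = (i, w, out, E)" "i \<in> I" "w \<in> V - {v}" "E \<in> T i w"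
      using D(1) unfolding D_def by blast
    obtain i' w' out' E' where
      y': "y' = (i', w', out', E')" "i' \<in> I" "w' \<in> V - {v}" "E' \<in> T i' w'"
      using D(2) unfolding D_def by blast
    have eq: "E(i := if out then (v, w) else (w, v)) = E'(i' := if out' then (v, w') else (w', v))"
      using \<Phi>_eq y(1) y'(1) by (simp add: \<Phi>_def)
    have ii: "i = i'"
    proof (rule ccontr)
      assume "i \<noteq> i'"
      then have "E' i = (if out then (v, w) else (w, v))" using fun_cong[OF eq, of i] by simp
      then show False using avoid[OF y'(4) y(2) \<open>i \<noteq> i'\<close>] by (auto split: if_splits)
    qed
    have "(if out then (v, w) else (w, v)) = (if out' then (v, w') else (w', v))"
      using fun_cong[OF eq, of i] ii by simp
    then have ow: "out = out'" "w = w'" using y(3) y'(3) by (auto split: if_splits)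
    have "E = E'"
    proof (rule PiE_ext[OF T_PiE[OF y(4)]])
      show "E' \<in> (I - {i}) \<rightarrow>\<^sub>E (V - {v}) \<times> (V - {v})" using T_PiE[OF y'(4)] ii by simp
      show "E j = E' j" if "j \<in> I - {i}" for j
        using fun_cong[OF eq, of j] that ii by simp
    qed
    then show "y = y'" using y(1) y'(1) ii ow by simp
  qed
  have img: "\<Phi> ` D = degree_trees V I d"
  proof (intro equalityI subsetI)
    fix F assume "F \<in> \<Phi> ` D"
    then obtain i w out E where i: "i \<in> I" and w: "w \<in> V - {v}" and E: "E \<in> T i w"
      and F: "F = E(i := if out then (v, w) else (w, v))"
      by (auto simp: D_def \<Phi>_def)
    have Fi: "F i = (v, w) \<or> F i = (w, v)" by (simp add: F)
    have same: "F j = E j" if "j \<in> I - {i}" for j using that by (simp add: F)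
    have "tree (V - {v}) (I - {i}) F"
      using E tree_cong[of "I - {i}" F E, OF same] by (simp add: T_def degree_trees_def)
    then have "tree (insert v (V - {v})) (insert i (I - {i})) F"
      by (rule tree_add_leaf) (use w Fi in auto)
    then have tree: "tree V I F" using i v by (simp add: insert_absorb)
    have "vertex_degree I F u = d u" if u: "u \<in> V" for u
    proof -
      have "vertex_degree I F u = vertex_degree (I - {i}) E u + of_bool (u = v) + of_bool (u = w)"
        using degree_remove[where E = F, OF fin(2) i Fi] degree_cong[of "I - {i}" F E, OF same] by simp
      moreover have "vertex_degree (I - {i}) E u = d u - of_bool (u = w)" if "u \<noteq> v"
        using E u that by (simp add: T_def degree_trees_def)
      moreover have "vertex_degree (I - {i}) E v = 0"
        using degree_outside[OF T_PiE[OF E]] by simp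
      ultimately show ?thesis using v w pos[OF u] by (cases "u = v"; cases "u = w") auto
    qed
    moreover have "F \<in> I \<rightarrow>\<^sub>E V \<times> V"
    proof (rule PiE_I)
      show "F j \<in> V \<times> V" if "j \<in> I" for j using tree that by (simp add: tree_def)
      show "F j = undefined" if "j \<notin> I" for j
        using PiE_arb[OF T_PiE[OF E], of j] that i by (auto simp: F)
    qed
    ultimately show "F \<in> degree_trees V I d" using tree by (simp add: degree_trees_def)
  next
    fix F assume F: "F \<in> degree_trees V I d"
    then have tree: "tree V I F" and PiE: "F \<in> I \<rightarrow>\<^sub>E V \<times> V"
      and deg: "\<And>u. u \<in> V \<Longrightarrow> vertex_degree I F u = d u" by (auto simp: degree_trees_def)
    obtain i w where i: "i \<in> I" and "w \<noteq> v" and Fi: "F i = (v, w) \<or> F i = (w, v)"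
      and other: "\<And>j. j \<in> I - {i} \<Longrightarrow> fst (F j) \<noteq> v \<and> snd (F j) \<noteq> v"
      using degree_one_edge[of I F v] deg[OF v(1)] v(2) fin(2) by metis
    then have w: "w \<in> V - {v}" using PiE_mem[OF PiE i] by auto
    define E where "E = restrict F (I - {i})"
    have same: "E j = F j" if "j \<in> I - {i}" for j using that by (simp add: E_def)
    have "tree (V - {v}) (I - {i}) E"
      using tree_remove_leaf[where E = F, OF tree i v(1) w Fi other] tree_cong[of "I - {i}" E F, OF same] by simp
    moreover have "vertex_degree (I - {i}) E u = (d(w := d w - 1)) u" if u: "u \<in> V - {v}" for u
      using degree_remove[where E = F, OF fin(2) i Fi, of u] degree_cong[of "I - {i}" E F, OF same]
        deg[of u] u by (cases "u = w") auto
    moreover have "E \<in> (I - {i}) \<rightarrow>\<^sub>E (V - {v}) \<times> (V - {v})"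
    proof (rule PiE_I)
      show "E j \<in> (V - {v}) \<times> (V - {v})" if "j \<in> I - {i}" for j
        using PiE_mem[OF PiE, of j] other[OF that] that same[OF that] by (auto simp: mem_Times_iff)
      show "E j = undefined" if "j \<notin> I - {i}" for j
        unfolding E_def restrict_def using that by (rule if_not_P)
    qed
    ultimately have "E \<in> T i w" by (auto simp: T_def degree_trees_def)
    then have in_D: "(i, w, F i = (v, w), E) \<in> D" using i w by (simp add: D_def)
    have F_eq: "F = E(i := if F i = (v, w) then (v, w) else (w, v))"
    proof
      fix j show "F j = (E(i := if F i = (v, w) then (v, w) else (w, v))) j"
        using Fi PiE_arb[OF PiE, of j] by (auto simp: E_def)
    qed
    have "F = \<Phi> (i, w, F i = (v, w), E)"
      unfolding \<Phi>_def prod.case by (rule F_eq)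
    then show "F \<in> \<Phi> ` D" using in_D by (rule image_eqI)
  qed
  have finT: "finite (T i w)" for i w
    unfolding T_def by (rule finite_degree_trees) (use fin in auto)
  have "card (degree_trees V I d) = card D" using card_image[OF inj] img by simp
  also have "\<dots> = (\<Sum>i\<in>I. \<Sum>w\<in>V - {v}. 2 * card (T i w))"
    unfolding D_def using fin finT by (simp add: card_cartesian_product finite_cartesian_product)
  finally show ?thesis by (simp add: T_def)
qed

text \<open>Induction with the leaf recursion: each of the \<open>card I\<close> labels and each \<open>w\<close> contributes a term
  proportional to \<open>d w - 1\<close>, and these numbers add up to \<open>card I - 1\<close> over the vertices that
  remain. The factor \<open>d w - 1\<close> also covers \<open>d w = 1\<close>, where no remaining tree exists.\<close>

lemma card_degree_trees:
  assumes "finite V" "finite I" "card V = Suc (card I)" "I \<noteq> {}"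
    and "\<And>v. v \<in> V \<Longrightarrow> d v > 0" "(\<Sum>v\<in>V. d v) = 2 * card I"
  shows "real (card (degree_trees V I d)) =
    2 ^ card I * fact (card I) * fact (card I - 1) / (\<Prod>v\<in>V. fact (d v - 1))"
  using assms
proof (induction "card I" arbitrary: V I d)
  case 0
  then show ?case by simp
next
  case (Suc k)
  note fin = Suc.prems(1,2) and cV = Suc.prems(3) and pos = Suc.prems(5) and sum = Suc.prems(6)
  have "sum d V = 2 * (card V - 1)" "V \<noteq> {}" using sum cV by auto
  then obtain v where v: "v \<in> V" "d v = 1"
    using leaf_exists[of V d] fin(1) pos by blast
  define V' where "V' = V - {v}"
  have V': "finite V'" "card V' = card I" using fin cV v by (auto simp: V'_def)
  have sum': "(\<Sum>w\<in>V'. d w) + 1 = 2 * card I"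
    using sum v fin by (simp add: V'_def sum.remove)
  define T where "T i w = degree_trees V' (I - {i}) (d(w := d w - 1))" for i w
  let ?p = "\<Prod>u\<in>V. fact (d u - 1) :: real"
  have p: "?p = (\<Prod>u\<in>V'. fact (d u - 1))"
    using v fin by (simp add: V'_def prod.remove)
  have rec: "real (card (degree_trees V I d)) = (\<Sum>i\<in>I. \<Sum>w\<in>V'. 2 * real (card (T i w)))"
    using card_degree_trees_leaf[where d = d, OF fin cV pos v] by (simp add: T_def V'_def)
  show ?case
  proof (cases k)
    case 0
    then have "card I = 1" using Suc.hyps(2) by simp
    then obtain i w where i: "I = {i}" and w: "V' = {w}"
      using V'(2) by (metis card_1_singletonE)
    then have dw: "d w = 1" using sum' by simp
    have "T i w = {\<lambda>_. undefined}"
      unfolding T_def degree_trees_def w i using dw by (auto simp: vertex_degree_def tree_single)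
    then show ?thesis using rec p i w dw by simp
  next
    case (Suc k')
    have step: "real (card (T i w)) = 2 ^ k * fact k * fact k' * real (d w - 1) / ?p"
      if i: "i \<in> I" and w: "w \<in> V'" for i w
    proof -
      have c: "card (I - {i}) = k" using fin i Suc.hyps(2) by simp
      have Ine: "I - {i} \<noteq> {}"
      proof
        assume "I - {i} = {}"
        with c Suc show False by simp
      qed
      have dw: "d w > 0" using pos w by (simp add: V'_def)
      show ?thesis
      proof (cases "d w = 1")
        case True
        have "T i w = {}"
        proof (rule ccontr)
          assume "T i w \<noteq> {}"
          then obtain E where "tree V' (I - {i}) E" "vertex_degree (I - {i}) E w = 0"
            using w True by (auto simp: T_def degree_trees_def)
          moreover have "card V' \<ge> 2" using V' Suc.hyps(2) Suc by simp
          ultimately show False using degree_pos w by fastforce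
        qed
        then show ?thesis using True by simp
      next
        case False
        then have dw2: "d w \<ge> 2" using dw by simp
        have "real (card (T i w)) = 2 ^ card (I - {i}) * fact (card (I - {i})) * fact (card (I - {i}) - 1)
            / (\<Prod>u\<in>V'. fact ((d(w := d w - 1)) u - 1))"
          unfolding T_def
        proof (rule Suc.hyps(1)[OF c[symmetric] V'(1) _ _ Ine])
          show "finite (I - {i})" using fin by simp
          show "card V' = Suc (card (I - {i}))" using V' Suc.hyps(2) c by simp
          show "(d(w := d w - 1)) u > 0" if "u \<in> V'" for u
            using that dw2 pos by (auto simp: V'_def)
          have "(\<Sum>u\<in>V'. (d(w := d w - 1)) u) + 1 = (\<Sum>u\<in>V'. d u)"
            using V'(1) w dw2 by (simp add: sum.remove[of _ w])
          then show "(\<Sum>u\<in>V'. (d(w := d w - 1)) u) = 2 * card (I - {i})"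
            using sum' c Suc.hyps(2) by simp
        qed
        also have "(\<Prod>u\<in>V'. fact ((d(w := d w - 1)) u - 1)) * real (d w - 1) = ?p"
        proof -
          have "fact (d w - 1) = real (d w - 1) * fact (d w - 1 - 1)"
            using dw2 by (subst fact_reduce) auto
          then show ?thesis unfolding p using V'(1) w by (simp add: prod.remove[of _ w])
        qed
        then have "(\<Prod>u\<in>V'. fact ((d(w := d w - 1)) u - 1)) = ?p / real (d w - 1)"
          using dw2 by (simp add: field_simps)
        finally show ?thesis using c Suc by (simp add: field_simps)
      qed
    qed
    have "(\<Sum>w\<in>V'. real (d w - 1)) = real (card I) - 1"
    proof -
      have "(\<Sum>w\<in>V'. real (d w - 1)) = (\<Sum>w\<in>V'. real (d w) - 1)"
        by (rule sum.cong[OF refl]) (use pos in \<open>fastforce simp: V'_def\<close>)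
      also have "\<dots> = real (\<Sum>w\<in>V'. d w) - real (card I)" using V' by (simp add: sum_subtractf)
      also have "real (\<Sum>w\<in>V'. d w) = 2 * real (card I) - 1" using arg_cong[OF sum', of real] by simp
      finally show ?thesis by simp
    qed
    then have sum_d: "(\<Sum>w\<in>V'. real (d w - 1)) = real k" using Suc.hyps(2) by simp
    have "real (card (degree_trees V I d))
        = (\<Sum>i\<in>I. \<Sum>w\<in>V'. 2 * 2 ^ k * fact k * fact k' / ?p * real (d w - 1))"
      unfolding rec by (intro sum.cong refl) (simp add: step)
    also have "\<dots> = real (card I) * (2 * 2 ^ k * fact k * fact k' / ?p * real k)"
      by (simp only: sum_distrib_left[symmetric] sum_d sum_constant) (simp only: mult.left_commute)
    also have "\<dots> = 2 ^ card I * fact (card I) * fact (card I - 1) / ?p"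
      unfolding Suc.hyps(2)[symmetric] using Suc by simp
    finally show ?thesis .
  qed
qed

section \<open>Drawing trees in the lattice\<close>

text \<open>Each edge is placed as a unit step in the direction that is its label.\<close>

definition drawing :: "'d set \<Rightarrow> ('d::finite \<Rightarrow> 'v \<times> 'v) \<Rightarrow> ('v \<Rightarrow> int ^ 'd) \<Rightarrow> bool" where
  "drawing I E g \<longleftrightarrow> (\<forall>i\<in>I. g (snd (E i)) = g (fst (E i)) + axis i 1)"

definition center :: "int ^ 'd \<Rightarrow> real ^ 'd" where
  "center x = (\<chi> i. real_of_int (x $ i))"

lemma center_add: "center (x + y) = center x + center y"
  by (simp add: center_def vec_eq_iff)

lemma center_axis [simp]: "center (axis i 1) = axis i 1"
  by (simp add: center_def vec_eq_iff axis_def)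

lemma proper_in_center: "proper_in k P \<longleftrightarrow> aff_dim (center ` P) = int k"
  by (simp add: proper_in_def center_def[abs_def])

lemma span_differences:
  fixes h :: "'v \<Rightarrow> 'a::real_vector"
  assumes "a \<in> S" "b \<in> S" "s \<in> S" "(\<lambda>x. h x - h s) ` (S - {s}) \<subseteq> B"
  shows "h b - h a \<in> span B"
proof -
  have *: "h x - h s \<in> span B" if "x \<in> S" for x
    using assms(4) that span_base[of "h x - h s" B] span_zero[of B] by (cases "x = s") auto
  have "h b - h a = (h b - h s) - (h a - h s)" by simp
  then show ?thesis using span_diff[OF *[OF assms(2)] *[OF assms(1)]] by simp
qed

lemma axes_spanning:
  assumes "\<And>i. axis i 1 \<in> span (B :: (real ^ 'd) set)"
  shows "span B = UNIV"
proof -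
  have "Basis \<subseteq> span B" using assms by (auto simp: Basis_vec_def)
  then have "span Basis \<subseteq> span B" by (rule span_minimal) (rule subspace_span)
  then show ?thesis by auto
qed

text \<open>If no edge crossed a cut into \<open>S\<close> and \<open>T\<close>, then all unit vectors would be differences inside
  \<open>S\<close> or inside \<open>T\<close>. Such differences span at most \<open>(card S - 1) + (card T - 1)\<close> dimensions, which
  is one less than the dimension of the space.\<close>

lemma drawing_tree:
  fixes g :: "'v \<Rightarrow> int ^ 'd::finite"
  assumes V: "finite V" "card V = Suc (CARD('d))" and E: "\<And>i. E i \<in> V \<times> V"
    and g: "drawing UNIV E g"
  shows "tree V UNIV E"
proof -
  have "\<exists>i\<in>UNIV. fst (E i) \<in> S \<longleftrightarrow> snd (E i) \<notin> S" if S: "S \<noteq> {}" "S \<subset> V" for S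
  proof (rule ccontr)
    assume no_cross: "\<not> ?thesis"
    define T where "T = V - S"
    obtain s t where st: "s \<in> S" "t \<in> T" using S by (auto simp: T_def)
    define h where "h = center \<circ> g"
    define B where "B = (\<lambda>x. h x - h s) ` (S - {s}) \<union> (\<lambda>x. h x - h t) ` (T - {t})"
    have fin: "finite S" "finite T" using V S by (auto simp: T_def dest: finite_subset)
    have "axis i 1 \<in> span B" for i
    proof -
      have "(fst (E i) \<in> S \<and> snd (E i) \<in> S) \<or> (fst (E i) \<in> T \<and> snd (E i) \<in> T)"
        using no_cross E[of i] by (auto simp: T_def mem_Times_iff)
      then have "h (snd (E i)) - h (fst (E i)) \<in> span B"
        using span_differences[of _ S _ s h B] span_differences[of _ T _ t h B] st
        by (auto simp: B_def)
      then show ?thesis using g by (simp add: drawing_def h_def center_add)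
    qed
    then have "span B = UNIV" by (rule axes_spanning)
    then have "dim (UNIV :: (real ^ 'd) set) \<le> card B"
      by (intro dim_le_card) (auto simp: B_def fin)
    also have "card B \<le> (card S - 1) + (card T - 1)"
      unfolding B_def
      by (rule order.trans[OF card_Un_le add_mono])
        (use fin st in \<open>auto intro!: order.trans[OF card_image_le]\<close>)
    also have "\<dots> < CARD('d)"
    proof -
      have "card S + card T = card V"
        using fin S by (subst card_Un_disjoint[symmetric]) (auto simp: T_def intro: arg_cong[of _ _ card])
      moreover have "card S > 0" "card T > 0" using st fin by (auto simp: card_gt_0_iff)
      ultimately show ?thesis using V(2) by simp
    qed
    finally show False by simp
  qed
  then show ?thesis using V E unfolding tree_def by simp
qed

lemma drawing_coordinate_const:
  assumes "tree V I E" "drawing I E g" "i \<notin> I" "v \<in> V" "w \<in> V"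
  shows "g v $ i = g w $ i"
  by (rule tree_const[OF assms(1) _ assms(4,5)])
    (use assms(2,3) in \<open>auto simp: drawing_def axis_def\<close>)

text \<open>Only the edge at a leaf \<open>v\<close> changes the coordinate of its label, so this coordinate has one value
  at \<open>v\<close> and another one at all other vertices. Hence \<open>v\<close> has coefficient zero, and the leaf can be
  removed.\<close>

lemma drawing_affine_independent:
  fixes u :: "'v \<Rightarrow> int"
  assumes "tree V I E" "drawing I E g"
    and "(\<Sum>v\<in>V. u v) = 0" "\<And>i. i \<in> I \<Longrightarrow> (\<Sum>v\<in>V. u v * g v $ i) = 0" "x \<in> V"
  shows "u x = 0"
  using assms
proof (induction arbitrary: x rule: tree_induct)
  case (single v)
  then show ?case by simp
next
  case (leaf V I v w i)
  have fin: "finite V" using leaf(1) by (simp add: tree_def)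
  have gI: "drawing I E g" using leaf.prems(1) by (simp add: drawing_def)
  have const: "g y $ i = g w $ i" if "y \<in> V" for y
    using drawing_coordinate_const[OF leaf(1) gI leaf(4) that leaf(3)] .
  have "g (snd (E i)) $ i = g (fst (E i)) $ i + 1"
    using leaf.prems(1) by (simp add: drawing_def axis_def)
  then have step: "g v $ i - g w $ i \<noteq> 0" using leaf(5) by (elim disjE) simp_all
  have "0 = (\<Sum>y\<in>insert v V. u y * g y $ i) - g w $ i * (\<Sum>y\<in>insert v V. u y)"
    using leaf.prems(2,3) by simp
  also have "\<dots> = (\<Sum>y\<in>insert v V. u y * (g y $ i - g w $ i))"
    by (simp add: sum_distrib_left right_diff_distrib sum_subtractf mult.commute)
  also have "\<dots> = u v * (g v $ i - g w $ i)"
    using fin leaf(2) const by simp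
  finally have v0: "u v = 0" using step by simp
  have "u y = 0" if "y \<in> V" for y
  proof (rule leaf(6)[OF gI _ _ that])
    show "(\<Sum>v\<in>V. u v) = 0" using leaf.prems(2) fin leaf(2) v0 by simp
    show "(\<Sum>v\<in>V. u v * g v $ j) = 0" if "j \<in> I" for j
      using leaf.prems(3)[of j] that fin leaf(2) v0 by simp
  qed
  then show ?case using v0 leaf.prems(4) by auto
qed

text \<open>Affine independence for points of the form \<open>p + b - a\<close>. Each neighbour of a drawn cell has
  this form, and each cell does with \<open>a = b\<close>.\<close>

lemma drawing_combination:
  fixes g :: "'v \<Rightarrow> int ^ 'd::finite"
  assumes "tree V UNIV E" "drawing UNIV E g"
    and "p \<in> V" "b \<in> V" "a \<in> V" "p' \<in> V" "b' \<in> V" "a' \<in> V"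
    and "g p + g b - g a = g p' + g b' - g a'" "x \<in> V"
  shows "of_bool (x = p) + of_bool (x = b) - of_bool (x = a)
       = (of_bool (x = p') + of_bool (x = b') - of_bool (x = a') :: int)"
proof -
  have fin: "finite V" using assms(1) by (simp add: tree_def)
  define u :: "'v \<Rightarrow> int" where "u x = of_bool (x = p) + of_bool (x = b) - of_bool (x = a)
       - (of_bool (x = p') + of_bool (x = b') - of_bool (x = a'))" for x
  have d: "(\<Sum>x\<in>V. of_bool (x = y) * f x) = f y" if "y \<in> V" for f :: "'v \<Rightarrow> int" and y
    using fin that by (simp add: of_bool_def if_distrib[of "\<lambda>z. z * _"] sum.delta' cong: if_cong)
  have c: "(\<Sum>v\<in>V. u v * f v) = f p + f b - f a - (f p' + f b' - f a')" for f :: "'v \<Rightarrow> int"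
    unfolding u_def left_diff_distrib distrib_right sum_subtractf sum.distrib
    by (simp only: d assms(3-8))
  have "u x = 0"
  proof (rule drawing_affine_independent[OF assms(1,2) _ _ assms(10)])
    show "(\<Sum>v\<in>V. u v) = 0" using c[of "\<lambda>_. 1"] by simp
    show "(\<Sum>v\<in>V. u v * g v $ i) = 0" for i
      using assms(9) by (subst c) (simp add: vec_eq_iff)
  qed
  then show ?thesis by (simp add: u_def)
qed

lemma drawing_inj:
  fixes g :: "'v \<Rightarrow> int ^ 'd::finite"
  assumes "tree V UNIV E" "drawing UNIV E g"
  shows "inj_on g V"
proof (rule inj_onI)
  fix a b assume "a \<in> V" "b \<in> V" "g a = g b"
  then show "a = b"
    using drawing_combination[OF assms, of a a a b a a a] by (auto split: if_splits)
qed

lemma drawing_unique_edges: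
  fixes g :: "'v \<Rightarrow> int ^ 'd::finite"
  assumes "tree V UNIV E" "drawing UNIV E g" "tree V UNIV E'" "drawing UNIV E' g"
  shows "E = E'"
proof
  fix i
  obtain a b a' b' where e: "E i = (a, b)" "E' i = (a', b')" by fastforce
  then have in_V: "a \<in> V" "b \<in> V" "a' \<in> V" "b' \<in> V"
    using assms(1,3) unfolding tree_def by (metis SigmaE2 UNIV_I)+
  have eq: "g b = g a + axis i 1" "g b' = g a' + axis i 1"
    using assms(2,4) e by (auto simp: drawing_def dest: spec[of _ i])
  then have "a \<noteq> b" by (auto simp: axis_eq_0_iff)
  have "g b + g a' - g a = g b' + g a - g a" using eq by simp
  note comb = drawing_combination[OF assms(1,2) in_V(2,3,1) in_V(4,1,1) this]
  have "a = a'" using comb[OF in_V(1)] \<open>a \<noteq> b\<close> by (auto simp: of_bool_def split: if_splits)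
  moreover from this have "b = b'"
    using comb[OF in_V(2)] \<open>a \<noteq> b\<close> by (auto simp: of_bool_def split: if_splits)
  ultimately show "E i = E' i" using e by simp
qed

lemma drawing_proper:
  fixes g :: "'v \<Rightarrow> int ^ 'd::finite"
  assumes "tree V UNIV E" "drawing UNIV E g"
  shows "proper_in CARD('d) (g ` V)"
proof -
  obtain v where v: "v \<in> V" using assms(1) by (fastforce simp: tree_def)
  let ?B = "(\<lambda>x. x - center (g v)) ` center ` g ` V"
  have "axis i 1 \<in> span ?B" for i
  proof -
    have "E i \<in> V \<times> V" using assms(1) by (simp add: tree_def)
    then have "(center \<circ> g) (snd (E i)) - (center \<circ> g) (fst (E i)) \<in> span ?B"
      by (intro span_differences[OF _ _ v]) (auto simp: mem_Times_iff)
    then show ?thesis using assms(2) by (simp add: drawing_def center_add)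
  qed
  then have "span ?B = UNIV" by (rule axes_spanning)
  then have "dim ?B = CARD('d)" using dim_span[of ?B] by simp
  moreover have "aff_dim (center ` g ` V) = int (dim ?B)"
    by (rule aff_dim_eq_dim_subtract) (use v in \<open>auto intro: hull_inc\<close>)
  ultimately show ?thesis by (simp add: proper_in_center)
qed

lemma cell_adjacent_sym:
  assumes "cell_adjacent x y"
  shows "cell_adjacent y x"
proof -
  obtain i where "y = x + axis i 1 \<or> y = x - axis i 1"
    using assms unfolding cell_adjacent_def by blast
  then have "x = y - axis i 1 \<or> x = y + axis i 1" by auto
  then show ?thesis unfolding cell_adjacent_def by blast
qed

lemma drawing_polycube:
  fixes g :: "'v \<Rightarrow> int ^ 'd::finite"
  assumes "tree V UNIV E" "drawing UNIV E g"
  shows "polycube (card V) (g ` V)"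
proof -
  let ?R = "{(u, v). u \<in> g ` V \<and> v \<in> g ` V \<and> cell_adjacent u v}"
  have "(g v, g w) \<in> ?R\<^sup>*" if "v \<in> V" "w \<in> V" for v w
  proof -
    have sym: "sym ?R"
      by (auto simp: sym_def intro: cell_adjacent_sym)
    have edge: "(g (fst (E i)), g (snd (E i))) \<in> ?R" for i
    proof -
      have "E i \<in> V \<times> V" using assms(1) by (simp add: tree_def)
      then have "g (fst (E i)) \<in> g ` V" "g (snd (E i)) \<in> g ` V" by auto
      moreover have "g (snd (E i)) = g (fst (E i)) + axis i 1"
        using assms(2) by (simp add: drawing_def)
      ultimately show ?thesis unfolding cell_adjacent_def by blast
    qed
    have "((g v, g v) \<in> ?R\<^sup>*) = ((g v, g w) \<in> ?R\<^sup>*)"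
    proof (rule tree_const[OF assms(1) _ that])
      fix i
      show "((g v, g (fst (E i))) \<in> ?R\<^sup>*) = ((g v, g (snd (E i))) \<in> ?R\<^sup>*)"
        using edge[of i] symD[OF sym edge[of i]] by (meson rtrancl.rtrancl_into_rtrancl)
    qed
    then show ?thesis by blast
  qed
  then have "face_connected (g ` V)" unfolding face_connected_def by blast
  moreover have "finite V" using assms(1) by (simp add: tree_def)
  ultimately show ?thesis
    unfolding polycube_def using card_image[OF drawing_inj[OF assms]] by simp
qed

text \<open>Without a step in direction \<open>i\<close> the coordinate \<open>i\<close> is constant on a connected set, which then lies
  in a hyperplane.\<close>

lemma proper_has_edges:
  fixes P :: "(int ^ 'd::finite) set"
  assumes "face_connected P" "proper_in CARD('d) P"
  shows "\<exists>p\<in>P. p + axis i 1 \<in> P"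
proof (rule ccontr)
  assume none: "\<not> ?thesis"
  let ?R = "{(u, v). u \<in> P \<and> v \<in> P \<and> cell_adjacent u v}"
  have "P \<noteq> {}" using assms(2) by (auto simp: proper_in_center)
  then obtain q where q: "q \<in> P" by blast
  have step: "u $ i = v $ i" if uv: "(u, v) \<in> ?R" for u v
  proof -
    obtain j where j: "v = u + axis j 1 \<or> v = u - axis j 1" using uv by (auto simp: cell_adjacent_def)
    have "j \<noteq> i" using j uv none by (auto simp: algebra_simps)
    then show ?thesis using j by (auto simp: axis_def)
  qed
  have "p $ i = q $ i" if p: "p \<in> P" for p
  proof -
    have "(q, p) \<in> ?R\<^sup>*" using assms(1) p q unfolding face_connected_def by blast
    then show ?thesis
    proof (induction rule: rtrancl_induct)
      case (step y z)
      then show ?case using \<open>\<And>u v. (u, v) \<in> ?R \<Longrightarrow> u $ i = v $ i\<close>[of y z] by simp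
    qed simp
  qed
  then have "center ` P \<subseteq> {x. axis i 1 \<bullet> x = of_int (q $ i)}"
    by (auto simp: center_def inner_axis')
  then have "aff_dim (center ` P) \<le> aff_dim {x :: real ^ 'd. axis i 1 \<bullet> x = of_int (q $ i)}"
    by (rule aff_dim_subset)
  also have "\<dots> = int CARD('d) - 1"
    by (subst aff_dim_hyperplane) (simp_all add: axis_eq_0_iff)
  finally show False using assms(2) by (simp add: proper_in_center)
qed

text \<open>One edge is chosen per direction. Any choice works, as the dimension argument of
  \<open>drawing_tree\<close> then shows that the chosen edges form a tree.\<close>

lemma proper_polycube_drawing:
  fixes P :: "(int ^ 'd::finite) set"
  assumes "polycube n P" "proper_in CARD('d) P" "n = Suc (CARD('d))" "bij_betw g V P"
  shows "\<exists>E. tree V UNIV E \<and> drawing UNIV E g"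
proof -
  have "\<exists>e \<in> V \<times> V. g (snd e) = g (fst e) + axis i 1" for i
  proof -
    obtain p where "p \<in> P" "p + axis i 1 \<in> P"
      using proper_has_edges assms(1,2) unfolding polycube_def by blast
    moreover have "g ` V = P" using assms(4) by (simp add: bij_betw_def)
    ultimately show ?thesis by force
  qed
  then obtain E where E: "E i \<in> V \<times> V" "g (snd (E i)) = g (fst (E i)) + axis i 1" for i
    by metis
  have "drawing UNIV E g" using E by (simp add: drawing_def)
  moreover have "finite V" "card V = Suc CARD('d)"
    using assms bij_betw_finite[OF assms(4)] bij_betw_same_card[OF assms(4)]
    by (auto simp: polycube_def)
  ultimately show ?thesis using drawing_tree[of V E g] E(1) by blast
qed

section \<open>The perimeter of a drawn tree\<close>

lemma card_unordered_pairs: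
  fixes X :: "'a::linorder set"
  assumes "finite X"
  shows "2 * card {(p, b) \<in> X \<times> X. p \<le> b} = card X * (card X + 1)"
proof -
  let ?A = "{(p, b) \<in> X \<times> X. p \<le> b}" and ?B = "{(p, b) \<in> X \<times> X. b \<le> p}"
  have fin: "finite ?A" "finite ?B"
    by (rule finite_subset[of _ "X \<times> X"]; use assms in auto)+
  have "card ?B = card ?A"
    by (rule bij_betw_same_card[of prod.swap]) (rule bij_betwI[of _ _ _ prod.swap], auto)
  moreover have "?A \<union> ?B = X \<times> X" by auto
  moreover have "card (?A \<inter> ?B) = card X"
    by (rule bij_betw_same_card[of fst]) (rule bij_betwI[of _ _ _ "\<lambda>x. (x, x)"], auto)
  ultimately show ?thesis
    using card_Un_Int[OF fin] by (simp add: card_cartesian_product)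
qed

definition neighbours :: "('e \<Rightarrow> 'v \<times> 'v) \<Rightarrow> 'v \<Rightarrow> 'v set" where
  "neighbours E a = {b. \<exists>i. E i = (a, b) \<or> E i = (b, a)}"

lemma drawing_no_loop:
  fixes g :: "'v \<Rightarrow> int ^ 'd::finite"
  assumes "drawing UNIV E g"
  shows "fst (E i) \<noteq> snd (E i)"
proof
  assume "fst (E i) = snd (E i)"
  moreover have "g (snd (E i)) = g (fst (E i)) + axis i 1" using assms by (simp add: drawing_def)
  ultimately show False by (simp add: axis_eq_0_iff)
qed

lemma neighbours_step:
  fixes g :: "'v \<Rightarrow> int ^ 'd::finite"
  assumes "drawing UNIV E g" "b \<in> neighbours E a"
  shows "\<exists>i. g b = g a + axis i 1 \<or> g b = g a - axis i 1"
proof -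
  obtain i where i: "E i = (a, b) \<or> E i = (b, a)" using assms(2) by (auto simp: neighbours_def)
  have "g (snd (E i)) = g (fst (E i)) + axis i 1" using assms(1) by (simp add: drawing_def)
  then have "g b = g a + axis i 1 \<or> g b = g a - axis i 1" using i by (elim disjE) simp_all
  then show ?thesis ..
qed

lemma step_neighbours:
  fixes g :: "'v \<Rightarrow> int ^ 'd::finite"
  assumes "drawing UNIV E g" and "c = x + axis i 1 \<or> c = x - axis i 1"
  obtains a b where "b \<in> neighbours E a" "c = x + g b - g a"
proof -
  obtain a b where ab: "E i = (a, b)" by fastforce
  then have "g b = g a + axis i 1" using assms(1) by (auto simp: drawing_def dest: spec[of _ i])
  moreover have "b \<in> neighbours E a" "a \<in> neighbours E b" using ab by (auto simp: neighbours_def)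
  ultimately show thesis using that[of b a] that[of a b] assms(2) by auto
qed

lemma card_neighbours:
  fixes g :: "'v \<Rightarrow> int ^ 'd::finite"
  assumes "drawing UNIV E g"
  shows "card (neighbours E a) = vertex_degree UNIV E a"
proof -
  define J where "J = {i. fst (E i) = a \<or> snd (E i) = a}"
  define other where "other i = (if fst (E i) = a then snd (E i) else fst (E i))" for i
  have ends: "E i = (a, other i) \<or> E i = (other i, a)" if "i \<in> J" for i
    using that by (auto simp: J_def other_def prod_eq_iff)
  have edge: "g (snd (E i)) = g (fst (E i)) + axis i 1" for i
    using assms by (simp add: drawing_def)
  have step: "g (other i) - g a = axis i 1 \<or> g (other i) - g a = - axis i 1" if "i \<in> J" for i
    using ends[OF that] edge[of i] by (elim disjE) simp_all
  have "inj_on other J"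
  proof (rule inj_onI)
    fix i j assume ij: "i \<in> J" "j \<in> J" "other i = other j"
    define x where "x = g (other j) - g a"
    have "x $ i \<noteq> 0"
      using step[OF ij(1)] unfolding x_def ij(3)[symmetric] by (elim disjE) (simp_all add: axis_def)
    moreover have "x $ k = 0" if "k \<noteq> j" for k
      using step[OF ij(2)] that unfolding x_def by (elim disjE) (simp_all add: axis_def)
    ultimately show "i = j" by blast
  qed
  moreover have "other ` J = neighbours E a"
  proof
    show "other ` J \<subseteq> neighbours E a" using ends by (fastforce simp: neighbours_def)
    show "neighbours E a \<subseteq> other ` J"
    proof
      fix b assume "b \<in> neighbours E a"
      then obtain i where i: "E i = (a, b) \<or> E i = (b, a)" by (auto simp: neighbours_def)
      then have "i \<in> J" "other i = b"
        unfolding J_def other_def by (elim disjE; simp)+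
      then show "b \<in> other ` J" by blast
    qed
  qed
  ultimately have "card (neighbours E a) = card J" using card_image by metis
  moreover have "vertex_degree UNIV E a = card J"
  proof -
    have "of_bool (fst (E i) = a) + of_bool (snd (E i) = a) = (of_bool (i \<in> J) :: nat)" for i
      using drawing_no_loop[OF assms, of i] by (auto simp: J_def)
    then show ?thesis by (simp add: vertex_degree_def)
  qed
  ultimately show ?thesis by simp
qed

text \<open>The outer cells correspond bijectively to the triples of a vertex \<open>a\<close> and an unordered pair
  \<open>p, b\<close> (possibly \<open>p = b\<close>) of other vertices, at least one of which is a neighbour of \<open>a\<close>; the
  cell is \<open>p + b - a\<close>. The linear order on the vertices represents unordered pairs by ordered ones.\<close>

lemma drawing_perimeter:
  fixes V :: "'v::linorder set" and g :: "'v \<Rightarrow> int ^ 'd::finite"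
  assumes "tree V UNIV E" "drawing UNIV E g"
  shows "real (perimeter (g ` V)) =
    (\<Sum>a\<in>V. real CARD('d) * vertex_degree UNIV E a
            - real (vertex_degree UNIV E a) * (real (vertex_degree UNIV E a) - 1) / 2)"
proof -
  have fin: "finite V" and cV: "card V = Suc (CARD('d))" using assms(1) by (auto simp: tree_def)
  note comb = drawing_combination[OF assms]
  have nb_V: "b \<in> V" "a \<in> V" "b \<noteq> a" if "b \<in> neighbours E a" for a b
  proof -
    obtain i where i: "E i = (a, b) \<or> E i = (b, a)" using \<open>b \<in> neighbours E a\<close> by (auto simp: neighbours_def)
    have "E i \<in> V \<times> V" using assms(1) by (simp add: tree_def)
    then show "b \<in> V" "a \<in> V" "b \<noteq> a"
      using i drawing_no_loop[OF assms(2), of i] by auto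
  qed
  define Q where "Q a = {(p, b) \<in> (V - {a}) \<times> (V - {a}). p \<le> b
      \<and> (p \<in> neighbours E a \<or> b \<in> neighbours E a)}" for a
  define F where "F = (\<lambda>(a, p, b). g p + g b - g a)"
  have finQ: "finite (Q a)" for a
    by (rule finite_subset[of _ "V \<times> V"]) (use fin in \<open>auto simp: Q_def\<close>)
  have inj: "inj_on F (Sigma V Q)"
  proof (rule inj_onI)
    fix y y' assume "y \<in> Sigma V Q" "y' \<in> Sigma V Q" and F_eq: "F y = F y'"
    then obtain a p b a' p' b' where y: "y = (a, p, b)" "y' = (a', p', b')"
      and a: "a \<in> V" "(p, b) \<in> Q a" and a': "a' \<in> V" "(p', b') \<in> Q a'"
      by auto
    have eq: "F (a, p, b) = F (a', p', b')" using F_eq y by simp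
    have in_V: "p \<in> V" "b \<in> V" "p' \<in> V" "b' \<in> V" and ne: "p \<noteq> a" "b \<noteq> a" "p' \<noteq> a'" "b' \<noteq> a'"
      and le: "p \<le> b" "p' \<le> b'"
      using a a' by (auto simp: Q_def)
    have c: "of_bool (x = p) + of_bool (x = b) - of_bool (x = a)
       = (of_bool (x = p') + of_bool (x = b') - of_bool (x = a') :: int)" if "x \<in> V" for x
      using comb[OF in_V(1,2) a(1) in_V(3,4) a'(1) _ that] eq by (simp add: F_def)
    (* The only vertex with a negative coefficient is a. *)
    have aa: "a = a'" using c[OF a(1)] ne by (auto simp: of_bool_def split: if_splits)
    then have c': "of_bool (x = p) + of_bool (x = b)
       = (of_bool (x = p') + of_bool (x = b') :: int)" if "x \<in> V" for x
      using c[OF that] by simp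
    have "p = p' \<and> b = b'"
      using c'[OF in_V(1)] c'[OF in_V(2)] c'[OF in_V(3)] c'[OF in_V(4)] le
      by (auto simp: of_bool_def split: if_splits)
    with aa y show "y = y'" by blast
  qed
  have img: "F ` Sigma V Q = {c. c \<notin> g ` V \<and> (\<exists>p\<in>g ` V. cell_adjacent p c)}" (is "_ = ?C")
  proof (intro equalityI subsetI)
    fix c assume "c \<in> F ` Sigma V Q"
    then obtain a p b where a: "a \<in> V" "(p, b) \<in> Q a" and c: "c = g p + g b - g a"
      by (auto simp: F_def)
    then have in_V: "p \<in> V" "b \<in> V" and ne: "p \<noteq> a" "b \<noteq> a" by (auto simp: Q_def)
    have "c \<noteq> g q" if q: "q \<in> V" for q
    proof
      assume "c = g q"
      then have "g p + g b - g a = g q + g q - g q" using c by simp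
      from comb[OF in_V a(1) q q q this a(1)] show False
        using ne by (auto simp: of_bool_def split: if_splits)
    qed
    then have "c \<notin> g ` V" by blast
    moreover have "\<exists>q\<in>V. cell_adjacent (g q) c"
    proof -
      have "\<exists>q\<in>V. \<exists>r\<in>neighbours E a. c = g q + (g r - g a)"
        using a(2) c in_V by (force simp: Q_def algebra_simps)
      then obtain q r where q: "q \<in> V" and r: "r \<in> neighbours E a" and "c = g q + (g r - g a)"
        by blast
      moreover obtain i where "g r = g a + axis i 1 \<or> g r = g a - axis i 1"
        using neighbours_step[OF assms(2) r] by blast
      ultimately have "c = g q + axis i 1 \<or> c = g q - axis i 1" by auto
      then show ?thesis using q unfolding cell_adjacent_def by blast
    qed
    ultimately show "c \<in> ?C" by blast
  next
    fix c assume c: "c \<in> ?C"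
    then obtain q i where q: "q \<in> V" "c = g q + axis i 1 \<or> c = g q - axis i 1"
      unfolding cell_adjacent_def by blast
    obtain a b where ab: "b \<in> neighbours E a" "c = g q + g b - g a"
      using step_neighbours[OF assms(2) q(2)] .
    note V = nb_V[OF ab(1)]
    have "q \<noteq> a" using c ab V by auto
    then have "(q, b) \<in> Q a \<or> (b, q) \<in> Q a" using ab V q by (auto simp: Q_def)
    moreover have "c = F (a, q, b)" "c = F (a, b, q)" using ab by (auto simp: F_def algebra_simps)
    ultimately show "c \<in> F ` Sigma V Q" using V by blast
  qed
  have cardQ: "real (card (Q a)) = real CARD('d) * vertex_degree UNIV E a
      - real (vertex_degree UNIV E a) * (real (vertex_degree UNIV E a) - 1) / 2" if a: "a \<in> V" for a
  proof -
    define X where "X = V - {a}"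
    define Y where "Y = X - neighbours E a"
    define d where "d = vertex_degree UNIV E a"
    let ?pairs = "\<lambda>Z :: 'v set. {(p, b) \<in> Z \<times> Z. p \<le> b}"
    have finXY: "finite X" "finite Y" using fin by (auto simp: X_def Y_def)
    have sub: "neighbours E a \<subseteq> X" unfolding X_def using nb_V(1) nb_V(3)[of a a] by blast
    have cX: "card X = CARD('d)" using cV a fin by (simp add: X_def)
    have "card Y = card X - d"
      using sub finXY card_neighbours[OF assms(2)] by (simp add: Y_def d_def card_Diff_subset finite_subset)
    moreover have "d \<le> card X"
      using card_mono[OF finXY(1) sub] card_neighbours[OF assms(2)] by (simp add: d_def)
    ultimately have cY: "real (card Y) = real (card X) - d" by simp
    (* From all pairs avoiding a, discard those without a neighbour of a. *)
    have "Q a = ?pairs X - ?pairs Y" by (auto simp: Q_def X_def Y_def)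
    moreover have "finite (?pairs Y)"
      by (rule finite_subset[of _ "Y \<times> Y"]) (use finXY in auto)
    moreover have "?pairs Y \<subseteq> ?pairs X" by (auto simp: Y_def)
    moreover have "finite (?pairs X)"
      by (rule finite_subset[of _ "X \<times> X"]) (use finXY in auto)
    ultimately have "real (card (Q a)) = real (card (?pairs X)) - real (card (?pairs Y))"
      by (simp add: card_Diff_subset card_mono of_nat_diff)
    moreover have "2 * real (card (?pairs Z)) = real (card Z) * (real (card Z) + 1)"
      if "finite Z" for Z :: "'v set"
      using arg_cong[OF card_unordered_pairs[OF that], of real] by (simp add: algebra_simps)
    ultimately have "2 * real (card (Q a)) = real (card X) * (real (card X) + 1)
        - real (card Y) * (real (card Y) + 1)"
      using finXY by (simp add: right_diff_distrib)
    then show ?thesis unfolding cY cX d_def[symmetric] by (simp add: field_simps)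
  qed
  have "perimeter (g ` V) = card (Sigma V Q)"
    using card_image[OF inj] img by (simp add: perimeter_def)
  also have "\<dots> = (\<Sum>a\<in>V. card (Q a))" using fin finQ by simp
  finally show ?thesis using cardQ by simp
qed

section \<open>Polycubes as drawn trees\<close>

lemma translation_equiv: "equiv UNIV (translation_rel :: ((int ^ 'd) set \<times> (int ^ 'd) set) set)"
proof (rule equivI)
  show "refl (translation_rel :: ((int ^ 'd) set \<times> (int ^ 'd) set) set)"
  proof (rule refl_onI)
    fix P :: "(int ^ 'd) set"
    have "P = (\<lambda>x. x + 0) ` P" by simp
    then show "(P, P) \<in> translation_rel" unfolding translation_rel_def by blast
  qed
  show "sym (translation_rel :: ((int ^ 'd) set \<times> (int ^ 'd) set) set)"
  proof (rule symI)
    fix P Q :: "(int ^ 'd) set"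
    assume "(P, Q) \<in> translation_rel"
    then obtain v where "Q = (\<lambda>x. x + v) ` P" by (auto simp: translation_rel_def)
    then have "P = (\<lambda>x. x + - v) ` Q" by (simp add: image_image)
    then show "(Q, P) \<in> translation_rel" unfolding translation_rel_def by blast
  qed
  show "trans (translation_rel :: ((int ^ 'd) set \<times> (int ^ 'd) set) set)"
  proof (rule transI)
    fix P Q R :: "(int ^ 'd) set"
    assume "(P, Q) \<in> translation_rel" "(Q, R) \<in> translation_rel"
    then obtain v w where "Q = (\<lambda>x. x + v) ` P" "R = (\<lambda>x. x + w) ` Q"
      by (auto simp: translation_rel_def)
    then have "R = (\<lambda>x. x + (v + w)) ` P" by (simp add: image_image add.assoc)
    then show "(P, R) \<in> translation_rel" unfolding translation_rel_def by blast
  qed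
qed simp

lemma translation_fixes_finite:
  fixes P :: "(int ^ 'd) set"
  assumes "finite P" "P \<noteq> {}" "(\<lambda>x. x + c) ` P = P"
  shows "c = 0"
proof -
  have "c $ i = 0" for i
  proof -
    have "inj_on (\<lambda>x. x + c) P" by (simp add: inj_on_def)
    then have "(\<Sum>x\<in>(\<lambda>x. x + c) ` P. x $ i) = (\<Sum>x\<in>P. (x + c) $ i)"
      by (simp add: sum.reindex)
    then have "(\<Sum>x\<in>P. x $ i) = (\<Sum>x\<in>P. x $ i) + int (card P) * c $ i"
      by (simp add: assms(3) sum.distrib)
    then show ?thesis using assms(1,2) by simp
  qed
  then show ?thesis by (simp add: vec_eq_iff)
qed

lemma card_fibres:
  assumes "finite S" "finite T" "f ` S \<subseteq> T"
  shows "card S = (\<Sum>y\<in>T. card {x \<in> S. f x = y})"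
  using sum.group[OF assms, of "\<lambda>_. 1 :: nat"] by simp

text \<open>All drawings of a tree are translates of each other, so the choice of the drawing does not
  matter.\<close>

definition tree_shape :: "'v set \<Rightarrow> ('d::finite \<Rightarrow> 'v \<times> 'v) \<Rightarrow> (int ^ 'd) set set" where
  "tree_shape V E = translation_rel `` {(SOME g. drawing UNIV E g) ` V}"

lemma tree_shape_drawing:
  assumes "tree V UNIV E" "drawing UNIV E g"
  shows "tree_shape V E = translation_rel `` {g ` V}"
proof -
  let ?h = "SOME g. drawing UNIV E g"
  have h: "drawing UNIV E ?h" by (rule someI[of "drawing UNIV E", OF assms(2)])
  obtain c where "\<And>v. v \<in> V \<Longrightarrow> ?h v = g v + c"
    using tree_potential_unique[OF assms(1), of g "\<lambda>i. axis i 1" ?h] assms(2) h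
    unfolding drawing_def by blast
  then have "?h ` V = (\<lambda>x. x + c) ` g ` V" by (simp add: image_image)
  then have "(g ` V, ?h ` V) \<in> translation_rel" unfolding translation_rel_def by blast
  then show ?thesis unfolding tree_shape_def
    by (rule equiv_class_eq[OF translation_equiv, symmetric])
qed

lemma drawing_cong:
  assumes "tree V I E" "\<And>v. v \<in> V \<Longrightarrow> g v = g' v"
  shows "drawing I E g \<longleftrightarrow> drawing I E g'"
proof -
  have "fst (E i) \<in> V \<and> snd (E i) \<in> V" if "i \<in> I" for i
    using assms(1) that unfolding tree_def by (metis mem_Times_iff)
  then show ?thesis using assms(2) by (simp add: drawing_def)
qed

lemma tree_shape_eqD:
  fixes V :: "'v set" and P :: "(int ^ 'd::finite) set"
  assumes "tree V UNIV E" "tree_shape V E = translation_rel `` {P}"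
  obtains g where "drawing UNIV E g" "g ` V = P"
proof -
  obtain g :: "'v \<Rightarrow> int ^ 'd" where g: "drawing UNIV E g"
    using tree_potential[OF assms(1), of "\<lambda>i. axis i 1"] by (auto simp: drawing_def)
  then have "translation_rel `` {g ` V} = translation_rel `` {P}"
    using tree_shape_drawing[OF assms(1)] assms(2) by simp
  then have "(g ` V, P) \<in> translation_rel"
    using eq_equiv_class[OF _ translation_equiv] by blast
  then obtain v where "P = (\<lambda>x. x + v) ` g ` V" by (auto simp: translation_rel_def)
  then have "(\<lambda>x. g x + v) ` V = P" by (simp add: image_image)
  moreover have "drawing UNIV E (\<lambda>x. g x + v)" using g by (simp add: drawing_def)
  ultimately show thesis using that by blast
qed

text \<open>The trees of a translation class correspond to the numberings of the cells of a representative
  \<open>P\<close>: a numbering is the drawing of exactly one tree, and two numberings of \<open>P\<close> that draw the same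
  tree differ by a translation, which has to be zero because \<open>P\<close> is finite.\<close>

lemma card_tree_shape_fibre:
  fixes P :: "(int ^ 'd::finite) set"
  assumes P: "polycube n P" "proper_in CARD('d) P" and n: "n = Suc CARD('d)"
  shows "card {E :: 'd \<Rightarrow> nat \<times> nat. tree {..<n} UNIV E \<and> tree_shape {..<n} E = translation_rel `` {P}}
       = fact n" (is "card ?F = _")
proof -
  have P': "finite P" "card P = n" "P \<noteq> {}" using P(1) n by (auto simp: polycube_def)
  define \<psi> where "\<psi> xs = (SOME E. tree {..<n} UNIV E \<and> drawing UNIV E ((!) xs))"
    for xs :: "(int ^ 'd) list"
  have xsD: "distinct xs" "set xs = P" "length xs = n" if "xs \<in> permutations_of_set P" for xs
    using that P' by (auto simp: permutations_of_set_def dest: distinct_card)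
  have img_nth: "(!) xs ` {..<n} = P" if "xs \<in> permutations_of_set P" for xs
    using xsD[OF that] by (auto simp: set_conv_nth)
  have \<psi>: "tree {..<n} UNIV (\<psi> xs)" "drawing UNIV (\<psi> xs) ((!) xs)"
    if "xs \<in> permutations_of_set P" for xs
  proof -
    have "bij_betw ((!) xs) {..<n} P" using xsD[OF that] by (intro bij_betw_nth) auto
    from proper_polycube_drawing[OF P n this]
    have "\<exists>E. tree {..<n} UNIV E \<and> drawing UNIV E ((!) xs)" .
    from someI_ex[OF this] show "tree {..<n} UNIV (\<psi> xs)" "drawing UNIV (\<psi> xs) ((!) xs)"
      by (simp_all add: \<psi>_def)
  qed
  have inj: "inj_on \<psi> (permutations_of_set P)"
  proof (rule inj_onI)
    fix xs ys assume xs: "xs \<in> permutations_of_set P" and ys: "ys \<in> permutations_of_set P"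
      and eq: "\<psi> xs = \<psi> ys"
    obtain c where c: "\<And>v. v \<in> {..<n} \<Longrightarrow> ys ! v = xs ! v + c"
      using tree_potential_unique[OF \<psi>(1)[OF xs], of "(!) xs" "\<lambda>i. axis i 1" "(!) ys"]
        \<psi>(2)[OF xs] \<psi>(2)[OF ys] eq
      unfolding drawing_def by auto
    then have "(!) ys ` {..<n} = (\<lambda>x. x + c) ` (!) xs ` {..<n}" by (simp add: image_image)
    then have "(\<lambda>x. x + c) ` P = P" using img_nth xs ys by simp
    then have "c = 0" using translation_fixes_finite P' by blast
    then show "xs = ys" using c xsD[OF xs] xsD[OF ys] by (intro nth_equalityI) auto
  qed
  have "\<psi> ` permutations_of_set P = ?F"
  proof (intro equalityI subsetI)
    fix E assume "E \<in> \<psi> ` permutations_of_set P"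
    then obtain xs where xs: "xs \<in> permutations_of_set P" and E: "E = \<psi> xs" by blast
    show "E \<in> ?F"
      using \<psi>[OF xs] tree_shape_drawing[OF \<psi>[OF xs]] img_nth[OF xs] E by simp
  next
    fix E assume "E \<in> ?F"
    then have tree: "tree {..<n} UNIV E" and shape: "tree_shape {..<n} E = translation_rel `` {P}"
      by auto
    obtain g where g: "drawing UNIV E g" "g ` {..<n} = P"
      using tree_shape_eqD[OF tree shape] .
    define xs where "xs = map g [0..<n]"
    have "set xs = P" using g(2) by (simp add: xs_def lessThan_atLeast0)
    moreover have "distinct xs"
      using drawing_inj[OF tree g(1)] by (simp add: xs_def distinct_map lessThan_atLeast0)
    ultimately have xs: "xs \<in> permutations_of_set P" by (simp add: permutations_of_set_def)
    have "drawing UNIV E ((!) xs)"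
      using g(1) by (subst (asm) drawing_cong[OF tree, of _ "(!) xs"]) (simp_all add: xs_def)
    then have "E = \<psi> xs" using drawing_unique_edges[OF tree _ \<psi>[OF xs]] by blast
    then show "E \<in> \<psi> ` permutations_of_set P" using xs by blast
  qed
  then have "card ?F = card (permutations_of_set P)" using card_image[OF inj] by simp
  then show ?thesis using P' by simp
qed

text \<open>The perimeter is expressed by the degrees so that no drawing has to be chosen; the two agree by
  \<open>drawing_perimeter_t1\<close>.\<close>

definition perimeter_trees :: "nat \<Rightarrow> int \<Rightarrow> ('d \<Rightarrow> nat \<times> nat) set" where
  "perimeter_trees n t =
     {E. tree {..<n} UNIV E \<and> t1 n (map (vertex_degree UNIV E) [0..<n]) = real_of_int t}"

lemma drawing_perimeter_t1:
  fixes g :: "nat \<Rightarrow> int ^ 'd::finite"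
  assumes "tree {..<n} UNIV E" "drawing UNIV E g"
  shows "real (perimeter (g ` {..<n})) = t1 n (map (vertex_degree UNIV E) [0..<n])"
proof -
  have n: "n = Suc CARD('d)" using assms(1) by (simp add: tree_def)
  define m where "m = CARD('d)"
  define \<delta> where "\<delta> = vertex_degree UNIV E"
  have "(\<Sum>a<n. \<delta> a) = 2 * m"
    unfolding \<delta>_def m_def by (rule sum_degree) (use assms(1) in \<open>auto simp: tree_def\<close>)
  then have s: "(\<Sum>a<n. real (\<delta> a)) = 2 * real m"
    by (metis of_nat_sum of_nat_mult of_nat_numeral)
  have "real (perimeter (g ` {..<n})) = (\<Sum>a<n. real m * \<delta> a - real (\<delta> a) * (real (\<delta> a) - 1) / 2)"
    using drawing_perimeter[OF assms] by (simp add: \<delta>_def m_def)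
  also have "\<dots> = (\<Sum>a<n. (real m + 1 / 2) * \<delta> a - 1 / 2 * real (\<delta> a) ^ 2)"
    by (intro sum.cong refl) (simp add: field_simps power2_eq_square)
  also have "\<dots> = (real m + 1 / 2) * (\<Sum>a<n. real (\<delta> a)) - 1 / 2 * (\<Sum>a<n. real (\<delta> a) ^ 2)"
    by (simp add: sum_subtractf sum_distrib_left)
  also have "\<dots> = t1 n (map \<delta> [0..<n])"
  proof -
    have "(\<Sum>a<n. real (\<delta> a) ^ 2) = (\<Sum>i<n. real (map \<delta> [0..<n] ! i) ^ 2)" by simp
    moreover have "real n = real m + 1" using n by (simp add: m_def)
    ultimately show ?thesis unfolding s t1_def by (simp add: algebra_simps)
  qed
  finally show ?thesis by (simp add: \<delta>_def)
qed

lemma finite_perimeter_trees: "finite (perimeter_trees n t :: ('d::finite \<Rightarrow> nat \<times> nat) set)"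
proof (rule finite_subset)
  show "(perimeter_trees n t :: ('d \<Rightarrow> nat \<times> nat) set) \<subseteq> UNIV \<rightarrow>\<^sub>E {..<n} \<times> {..<n}"
    by (auto simp: perimeter_trees_def tree_def PiE_UNIV_domain)
  show "finite ((UNIV :: 'd set) \<rightarrow>\<^sub>E {..<n} \<times> {..<n})" by (intro finite_PiE) auto
qed

lemma card_perimeter_trees_polycubes:
  assumes n: "n = Suc CARD('d::finite)"
  shows "card (perimeter_trees n t :: ('d \<Rightarrow> nat \<times> nat) set)
       = fact n * num_proper_polycubes TYPE('d) n t"
proof -
  define \<P> where "\<P> = {P :: (int ^ 'd) set. polycube n P \<and> proper_in CARD('d) P \<and> int (perimeter P) = t}"
  let ?T = "perimeter_trees n t :: ('d \<Rightarrow> nat \<times> nat) set"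
  have perim: "t1 n (map (vertex_degree UNIV E) [0..<n]) = real_of_int t \<longleftrightarrow> int (perimeter (g ` {..<n})) = t"
    if "tree {..<n} UNIV E" "drawing UNIV E g" for E and g :: "nat \<Rightarrow> int ^ 'd"
    unfolding drawing_perimeter_t1[OF that, symmetric] by linarith
  have img: "tree_shape {..<n} ` ?T = \<P> // translation_rel"
  proof (intro equalityI subsetI)
    fix C assume "C \<in> tree_shape {..<n} ` ?T"
    then obtain E where C: "C = tree_shape {..<n} E" and tree: "tree {..<n} UNIV E"
      and t: "t1 n (map (vertex_degree UNIV E) [0..<n]) = real_of_int t" by (auto simp: perimeter_trees_def)
    obtain g :: "nat \<Rightarrow> int ^ 'd" where g: "drawing UNIV E g"
      using tree_potential[OF tree, of "\<lambda>i. axis i 1"] by (auto simp: drawing_def)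
    have "g ` {..<n} \<in> \<P>"
      using drawing_polycube[OF tree g] drawing_proper[OF tree g] perim[OF tree g] t by (simp add: \<P>_def)
    then show "C \<in> \<P> // translation_rel"
      using tree_shape_drawing[OF tree g] C by (auto intro: quotientI)
  next
    fix C assume "C \<in> \<P> // translation_rel"
    then obtain P where P: "P \<in> \<P>" "C = translation_rel `` {P}" by (auto elim: quotientE)
    then have P': "polycube n P" "proper_in CARD('d) P" by (auto simp: \<P>_def)
    obtain g where g: "bij_betw g {..<n} P"
      using P'(1) ex_bij_betw_nat_finite[of P] by (auto simp: polycube_def lessThan_atLeast0)
    obtain E where E: "tree {..<n} UNIV E" "drawing UNIV E g"
      using proper_polycube_drawing[OF P' n g] by blast
    have gP: "g ` {..<n} = P" using g by (simp add: bij_betw_def)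
    have "E \<in> ?T" using perim[OF E] P(1) E(1) gP by (simp add: perimeter_trees_def \<P>_def)
    moreover have "C = tree_shape {..<n} E" using tree_shape_drawing[OF E] gP P(2) by simp
    ultimately show "C \<in> tree_shape {..<n} ` ?T" by blast
  qed
  have fibre: "card {E \<in> ?T. tree_shape {..<n} E = C} = fact n" if "C \<in> \<P> // translation_rel" for C
  proof -
    obtain P where P: "P \<in> \<P>" "C = translation_rel `` {P}" using \<open>C \<in> \<P> // translation_rel\<close> by (auto elim: quotientE)
    then have P': "polycube n P" "proper_in CARD('d) P" by (auto simp: \<P>_def)
    have "E \<in> ?T" if E: "tree {..<n} UNIV E" "tree_shape {..<n} E = C" for E
    proof -
      obtain g where "drawing UNIV E g" "g ` {..<n} = P"
        using tree_shape_eqD[OF E(1)] E(2) P(2) by blast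
      then show ?thesis using perim[OF E(1)] P(1) E(1) by (auto simp: perimeter_trees_def \<P>_def)
    qed
    then have "{E \<in> ?T. tree_shape {..<n} E = C} = {E. tree {..<n} UNIV E \<and> tree_shape {..<n} E = C}"
      by (auto simp: perimeter_trees_def)
    then show ?thesis using card_tree_shape_fibre[OF P' n] P(2) by simp
  qed
  have "card ?T = (\<Sum>C\<in>\<P> // translation_rel. card {E \<in> ?T. tree_shape {..<n} E = C})"
    by (rule card_fibres) (use finite_perimeter_trees img in \<open>auto simp flip: img\<close>)
  also have "\<dots> = fact n * card (\<P> // translation_rel)" using fibre by simp
  finally show ?thesis by (simp add: num_proper_polycubes_def \<P>_def)
qed

section \<open>Sorted degree sequences\<close>

lemma sum_nth_mset: "(\<Sum>i<length xs. f (xs ! i)) = (\<Sum>x\<in>#mset xs. f x :: 'a::comm_monoid_add)"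
proof -
  have "(\<Sum>x\<in>#mset xs. f x) = sum_list (map f xs)" by (metis mset_map sum_mset_sum_list)
  also have "\<dots> = (\<Sum>i<length xs. f (xs ! i))"
    by (simp add: sum_list_sum_nth lessThan_atLeast0)
  finally show ?thesis ..
qed

lemma prod_nth_mset: "(\<Prod>i<length xs. f (xs ! i)) = (\<Prod>x\<in>#mset xs. f x :: 'a::comm_monoid_mult)"
proof -
  have "(\<Prod>x\<in>#mset xs. f x) = prod_list (map f xs)" by (metis mset_map prod_mset_prod_list)
  also have "\<dots> = (\<Prod>i<length xs. f (xs ! i))"
    by (simp add: prod.list_conv_set_nth lessThan_atLeast0)
  finally show ?thesis ..
qed

definition degree_lists :: "nat \<Rightarrow> int \<Rightarrow> nat list set" where
  "degree_lists n t = {\<delta>. length \<delta> = n \<and> (\<forall>d\<in>set \<delta>. d > 0) \<and> sum_list \<delta> = 2 * (n - 1)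
     \<and> t1 n \<delta> = real_of_int t}"

lemma finite_degree_lists: "finite (degree_lists n t)"
proof (rule finite_subset)
  show "degree_lists n t \<subseteq> {\<delta>. set \<delta> \<subseteq> {..2 * (n - 1)} \<and> length \<delta> = n}"
    unfolding degree_lists_def by (auto dest: member_le_sum_list)
  show "finite {\<delta>. set \<delta> \<subseteq> {..2 * (n - 1)} \<and> length \<delta> = n}"
    by (rule finite_lists_length_eq) simp
qed

lemma card_perimeter_trees:
  assumes n: "n = Suc CARD('d::finite)"
  shows "real (card (perimeter_trees n t :: ('d \<Rightarrow> nat \<times> nat) set)) =
    (\<Sum>\<delta>\<in>degree_lists n t.
       2 ^ (n - 1) * fact (n - 1) * fact (n - 2) / (\<Prod>i<n. fact (\<delta> ! i - 1)))"
proof -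
  let ?T = "perimeter_trees n t :: ('d \<Rightarrow> nat \<times> nat) set"
  define degs where "degs E = map (vertex_degree UNIV E) [0..<n]" for E :: "'d \<Rightarrow> nat \<times> nat"
  have "degs ` ?T \<subseteq> degree_lists n t"
  proof
    fix \<delta> assume "\<delta> \<in> degs ` ?T"
    then obtain E where \<delta>: "\<delta> = degs E" and tree: "tree {..<n} UNIV E" and t: "t1 n (degs E) = real_of_int t"
      by (auto simp: perimeter_trees_def degs_def)
    have "(\<Sum>v<n. vertex_degree UNIV E v) = 2 * CARD('d)"
      by (rule sum_degree) (use tree in \<open>auto simp: tree_def\<close>)
    then have "sum_list \<delta> = 2 * (n - 1)"
      using n by (simp add: \<delta> degs_def sum_list_sum_nth lessThan_atLeast0 del: upt_Suc)
    moreover have "d > 0" if "d \<in> set \<delta>" for d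
      using that degree_pos[OF tree] n by (auto simp: \<delta> degs_def)
    ultimately show "\<delta> \<in> degree_lists n t"
      using t by (simp add: degree_lists_def \<delta>) (simp add: degs_def)
  qed
  then have "card ?T = (\<Sum>\<delta>\<in>degree_lists n t. card {E \<in> ?T. degs E = \<delta>})"
    by (intro card_fibres finite_perimeter_trees finite_degree_lists)
  moreover have "real (card {E \<in> ?T. degs E = \<delta>})
      = 2 ^ (n - 1) * fact (n - 1) * fact (n - 2) / (\<Prod>i<n. fact (\<delta> ! i - 1))"
    if \<delta>: "\<delta> \<in> degree_lists n t" for \<delta>
  proof -
    have len: "length \<delta> = n" and pos: "\<And>i. i < n \<Longrightarrow> \<delta> ! i > 0" and sum: "sum_list \<delta> = 2 * (n - 1)"
      and t: "t1 n \<delta> = real_of_int t"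
      using \<delta> by (auto simp: degree_lists_def)
    have degs: "degs E = \<delta> \<longleftrightarrow> (\<forall>v\<in>{..<n}. vertex_degree UNIV E v = \<delta> ! v)" for E
      using len by (auto simp: degs_def list_eq_iff_nth_eq)
    have PiE: "E \<in> UNIV \<rightarrow>\<^sub>E {..<n} \<times> {..<n}" if "tree {..<n} UNIV E" for E :: "'d \<Rightarrow> nat \<times> nat"
      using that by (auto simp: tree_def PiE_UNIV_domain)
    have "{E \<in> ?T. degs E = \<delta>} = degree_trees {..<n} UNIV (\<lambda>v. \<delta> ! v)"
    proof (intro equalityI subsetI)
      fix E assume "E \<in> {E \<in> ?T. degs E = \<delta>}"
      then show "E \<in> degree_trees {..<n} UNIV (\<lambda>v. \<delta> ! v)"
        using PiE degs[of E] by (simp add: perimeter_trees_def degree_trees_def)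
    next
      fix E :: "'d \<Rightarrow> nat \<times> nat" assume "E \<in> degree_trees {..<n} UNIV (\<lambda>v. \<delta> ! v)"
      then have "tree {..<n} UNIV E" "degs E = \<delta>" using degs[of E] by (auto simp: degree_trees_def)
      then show "E \<in> {E \<in> ?T. degs E = \<delta>}" using t by (simp add: perimeter_trees_def degs_def)
    qed
    moreover have "(\<Sum>v<n. \<delta> ! v) = 2 * CARD('d)"
      using sum len n by (simp add: sum_list_sum_nth lessThan_atLeast0)
    ultimately show ?thesis
      using card_degree_trees[of "{..<n}" "UNIV :: 'd set" "\<lambda>v. \<delta> ! v"] pos n by simp
  qed
  ultimately show ?thesis by simp
qed

text \<open>A summand that does not depend on the order of the degrees may be summed over sorted sequences,
  weighted by the number of their rearrangements.\<close>

lemma sum_degree_lists_sorted: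
  fixes f :: "nat list \<Rightarrow> real"
  assumes "\<And>xs ys. mset xs = mset ys \<Longrightarrow> length xs = n \<Longrightarrow> f xs = f ys"
  shows "(\<Sum>\<delta>\<in>degree_lists n t. f \<delta>) = (\<Sum>\<delta> | \<delta> \<in> tree_degree_seqs n \<and> t1 n \<delta> = real_of_int t.
     real (card (permutations_of_multiset (mset \<delta>))) * f \<delta>)"
proof -
  let ?S = "{\<delta>. \<delta> \<in> tree_degree_seqs n \<and> t1 n \<delta> = real_of_int t}"
  have t1: "t1 n xs = t1 n ys" if "mset xs = mset ys" "length xs = n" for xs ys
  proof -
    have "length ys = n" using that mset_eq_length by fastforce
    then show ?thesis
      using sum_nth_mset[of "\<lambda>x. real x ^ 2" xs] sum_nth_mset[of "\<lambda>x. real x ^ 2" ys] that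
      by (simp add: t1_def)
  qed
  have S_sub: "?S \<subseteq> degree_lists n t" by (auto simp: tree_degree_seqs_def degree_lists_def)
  have perm: "ys \<in> degree_lists n t" if "xs \<in> degree_lists n t" "mset xs = mset ys" for xs ys
  proof -
    have "length ys = length xs" "set ys = set xs" "sum_list ys = sum_list xs"
      using that(2) by (metis mset_eq_length, metis set_mset_mset, metis sum_mset_sum_list)
    then show ?thesis using that(1) t1[OF that(2)] by (simp add: degree_lists_def)
  qed
  have "sort ` degree_lists n t \<subseteq> ?S"
  proof
    fix \<delta> assume "\<delta> \<in> sort ` degree_lists n t"
    then obtain xs where xs: "xs \<in> degree_lists n t" "\<delta> = sort xs" by blast
    then have "\<delta> \<in> degree_lists n t" using perm[of xs \<delta>] by simp
    then show "\<delta> \<in> ?S" using xs(2) by (simp add: degree_lists_def tree_degree_seqs_def)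
  qed
  then have "(\<Sum>\<delta>\<in>degree_lists n t. f \<delta>) = (\<Sum>\<delta>\<in>?S. \<Sum>xs | xs \<in> degree_lists n t \<and> sort xs = \<delta>. f xs)"
    by (intro sum.group[symmetric] finite_degree_lists finite_subset[OF S_sub])
  also have "\<dots> = (\<Sum>\<delta>\<in>?S. real (card (permutations_of_multiset (mset \<delta>))) * f \<delta>)"
  proof (rule sum.cong[OF refl])
    fix \<delta> assume \<delta>: "\<delta> \<in> ?S"
    then have "sorted \<delta>" "length \<delta> = n" by (auto simp: tree_degree_seqs_def)
    then have "sort xs = \<delta> \<longleftrightarrow> mset xs = mset \<delta>" for xs
      by (metis mset_sort properties_for_sort)
    then have "{xs. xs \<in> degree_lists n t \<and> sort xs = \<delta>} = permutations_of_multiset (mset \<delta>)"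
      using perm[of \<delta>] S_sub \<delta> by (auto simp: permutations_of_multiset_def)
    moreover have "f xs = f \<delta>" if "xs \<in> permutations_of_multiset (mset \<delta>)" for xs
      using assms[of \<delta> xs] that \<open>length \<delta> = n\<close> by (simp add: permutations_of_multiset_def)
    ultimately show "(\<Sum>xs | xs \<in> degree_lists n t \<and> sort xs = \<delta>. f xs)
        = real (card (permutations_of_multiset (mset \<delta>))) * f \<delta>" by simp
  qed
  finally show ?thesis .
qed

text \<open>A multinomial coefficient. Its product may stop at \<open>n - 1\<close>: the other \<open>n - 1\<close> degrees are
  positive, so that no degree exceeds \<open>2 (n - 1) - (n - 1)\<close>.\<close>

lemma card_rearrangements:
  assumes "\<delta> \<in> tree_degree_seqs n" "n \<ge> 2"
  shows "real (card (permutations_of_multiset (mset \<delta>))) =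
    fact n / (\<Prod>k=1..n-1. fact (alpha k \<delta>))" "(\<Sum>k=1..n-1. alpha k \<delta>) = n"
proof -
  have len: "length \<delta> = n" and pos: "\<And>d. d \<in> set \<delta> \<Longrightarrow> d > 0" and sum: "sum_list \<delta> = 2 * (n - 1)"
    using assms(1) by (auto simp: tree_degree_seqs_def)
  have alpha: "alpha k \<delta> = count (mset \<delta>) k" for k
    by (auto simp: alpha_def count_mset count_list_eq_length_filter length_filter_conv_card
        intro!: arg_cong[of _ _ card])
  have "d \<le> n - 1" if "d \<in> set \<delta>" for d
  proof -
    have "(\<Sum>x\<leftarrow>remove1 d \<delta>. 1) \<le> (\<Sum>x\<leftarrow>remove1 d \<delta>. x)"
      by (rule sum_list_mono) (use pos notin_set_remove1 in \<open>fastforce\<close>)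
    then have "n - 1 \<le> sum_list (remove1 d \<delta>)"
      using that len by (simp add: sum_list_triv length_remove1)
    moreover have "sum_list \<delta> = d + sum_list (remove1 d \<delta>)" using that by (rule sum_list_map_remove1[of _ _ "\<lambda>x. x", simplified])
    ultimately show ?thesis using sum by simp
  qed
  then have sub: "set_mset (mset \<delta>) \<subseteq> {1..n-1}" using pos by (force simp: Suc_le_eq)
  have out: "count (mset \<delta>) k = 0" if "k \<notin> set \<delta>" for k
    using that by (simp add: count_eq_zero_iff)
  have "(\<Prod>k=1..n-1. fact (alpha k \<delta>)) = (\<Prod>k\<in>set_mset (mset \<delta>). fact (count (mset \<delta>) k) :: real)"
    unfolding alpha by (rule prod.mono_neutral_right) (use sub in \<open>auto simp: out\<close>)
  moreover have "real (card (permutations_of_multiset (mset \<delta>)))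
      * (\<Prod>k\<in>set_mset (mset \<delta>). fact (count (mset \<delta>) k)) = fact n"
    using arg_cong[OF card_permutations_of_multiset_aux[of "mset \<delta>"], of real] len by simp
  ultimately show "real (card (permutations_of_multiset (mset \<delta>))) =
    fact n / (\<Prod>k=1..n-1. fact (alpha k \<delta>))"
    by (simp add: field_simps)
  have "(\<Sum>k=1..n-1. alpha k \<delta>) = (\<Sum>k\<in>set_mset (mset \<delta>). count (mset \<delta>) k)"
    unfolding alpha by (rule sum.mono_neutral_right) (use sub in \<open>auto simp: out\<close>)
  also have "\<dots> = size (mset \<delta>)" by (simp only: size_multiset_overloaded_eq)
  finally show "(\<Sum>k=1..n-1. alpha k \<delta>) = n" using len by simp
qed

theorem mainTheorem1:
  fixes n :: nat and t :: int
  assumes "n \<ge> 2"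
    and "CARD('d::finite) = n - 1"
  shows "real (num_proper_polycubes TYPE('d) n t) =
    (\<Sum>\<delta> | \<delta> \<in> tree_degree_seqs n \<and> t1 n \<delta> = real_of_int t.
       2 ^ (n - 1) * (1 / real n)
       * (fact (\<Sum>k=1..n-1. alpha k \<delta>) / (\<Prod>k=1..n-1. fact (alpha k \<delta>)))
       * (fact (\<Sum>i<n. (\<delta> ! i - 1)) / (\<Prod>i<n. fact (\<delta> ! i - 1))))"
proof -
  have n: "n = Suc CARD('d)" using assms by simp
  let ?S = "{\<delta>. \<delta> \<in> tree_degree_seqs n \<and> t1 n \<delta> = real_of_int t}"
  let ?p = "\<lambda>\<delta>. \<Prod>i<n. fact (\<delta> ! i - 1) :: real"
  have inv: "?p xs = ?p ys" if "mset xs = mset ys" "length xs = n" for xs ys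
  proof -
    have "length ys = n" using that mset_eq_length by fastforce
    then show ?thesis
      using prod_nth_mset[of "\<lambda>x. fact (x - 1) :: real" xs]
        prod_nth_mset[of "\<lambda>x. fact (x - 1) :: real" ys] that by simp
  qed
  have "fact n * real (num_proper_polycubes TYPE('d) n t)
      = real (card (perimeter_trees n t :: ('d \<Rightarrow> nat \<times> nat) set))"
    using arg_cong[OF card_perimeter_trees_polycubes[OF n, of t], of real] by simp
  also have "\<dots> = (\<Sum>\<delta>\<in>?S. real (card (permutations_of_multiset (mset \<delta>)))
      * (2 ^ (n - 1) * fact (n - 1) * fact (n - 2) / ?p \<delta>))"
    unfolding card_perimeter_trees[OF n]
    by (rule sum_degree_lists_sorted) (simp only: inv)
  finally have "real (num_proper_polycubes TYPE('d) n t)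
      = (\<Sum>\<delta>\<in>?S. real (card (permutations_of_multiset (mset \<delta>)))
      * (2 ^ (n - 1) * fact (n - 1) * fact (n - 2) / ?p \<delta>)) / fact n"
    by (simp add: field_simps)
  also have "\<dots> = (\<Sum>\<delta>\<in>?S. 2 ^ (n - 1) * (1 / real n)
       * (fact (\<Sum>k=1..n-1. alpha k \<delta>) / (\<Prod>k=1..n-1. fact (alpha k \<delta>)))
       * (fact (\<Sum>i<n. (\<delta> ! i - 1)) / ?p \<delta>))"
    unfolding sum_divide_distrib
  proof (rule sum.cong[OF refl])
    fix \<delta> assume "\<delta> \<in> ?S"
    then have \<delta>: "\<delta> \<in> tree_degree_seqs n" by simp
    then have len: "length \<delta> = n" and pos: "\<And>i. i < n \<Longrightarrow> \<delta> ! i > 0"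
      and sum: "(\<Sum>i<n. \<delta> ! i) = 2 * (n - 1)"
      by (auto simp: tree_degree_seqs_def sum_list_sum_nth lessThan_atLeast0)
    have "(\<Sum>i<n. \<delta> ! i - 1) + (\<Sum>i<n. 1) = (\<Sum>i<n. \<delta> ! i)"
      unfolding sum.distrib[symmetric] by (intro sum.cong refl) (use pos in force)
    then have exponent: "(\<Sum>i<n. \<delta> ! i - 1) = n - 2" using sum assms(1) by simp
    have "fact n = real n * fact (n - 1)" using assms(1) by (simp add: fact_reduce)
    then show "real (card (permutations_of_multiset (mset \<delta>)))
        * (2 ^ (n - 1) * fact (n - 1) * fact (n - 2) / ?p \<delta>) / fact n
      = 2 ^ (n - 1) * (1 / real n)
       * (fact (\<Sum>k=1..n-1. alpha k \<delta>) / (\<Prod>k=1..n-1. fact (alpha k \<delta>)))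
       * (fact (\<Sum>i<n. (\<delta> ! i - 1)) / ?p \<delta>)"
      unfolding card_rearrangements[OF \<delta> assms(1)] exponent
      by (simp add: field_simps)
  qed
  finally show ?thesis .
qed

end
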